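(* Fix $\gamma\in(0,\pi/4]$, $m\ge 1$ and outer weights $a\in\{\pm1\}^m$. Let $f(W;x)=a^{\top}\mathrm{ReLU}(Wx)$ for $W\in\mathbb{R}^{m\times 2}$, $x\in\mathbb{R}^2$, and let $\mathcal{L}^{(\gamma)}(W;f)=\mathbb{E}_{(x,y)\sim\mathcal{D}^{(\gamma)}}[-y\,f(W;x)]$, where $\mathcal{D}$ is the Gaussian mixture with parameters $\mu_1,\mu_2,\mu_3,\sigma$ described in the context and $\mathcal{D}^{(\gamma)}$ is its rotation by $\gamma$. Write $\mu=\mu_2$, $\omega=(\mu_1+\mu_3)/\mu_2$, $S=\mu/\sigma\in(0,\infty)$. Assume: (i) $\mu_1=\frac{\mu}{2}\left(\omega-\frac1\omega\right)$ and $\mu_3=\frac{\mu}{2}\left(\omega+\frac1\omega\right)$; (ii) with $c:=\Phi\left(S\cdot\min\left\{1,\frac{\omega-1/\omega}{2}\right\}\right)$ (where $\Phi$ is the standard Gaussian CDF), one has $c\in[\frac12,1]$, $\omega>\sqrt{2/c}$, and $$\frac1S\le\sqrt{\frac{\pi}{2}}\left(\frac12\left(c\,\omega-\frac2\omega\right)\sin\gamma-\cos\gamma\right).$$ Let $W_t$ be the $t$-th iterate of sign gradient descent, $W_{t+1}=W_t-\eta\,\mathrm{sign}(\nabla_W\mathcal{L}^{(\gamma)}(W_t;f))$ (entrywise sign), with any stepsize $\eta>0$ and any initialization $W_0\in\mathbb{R}^{m\times2}$. Then for all $k\in\{1,\dots,m\}$, $$\lim_{t\to\infty}\frac{(W_t)_{k,:}}{\|(W_t)_{k,:}\|}=\frac{a_k}{\sqrt2}[1,1]^{\top}.$$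 In particular, this solution yields the classification rule $$\lim_{t\to\infty}\mathrm{sign}(f(W_t;x))=\mathrm{sign}(x_1+x_2),$$ whose decision boundary is the subspace $\{x\in\mathbb{R}^2\mid x_1=-x_2\}$.
   Context: $\mathcal{D}$ is the distribution of $(x,y)\in\mathbb{R}^2\times\{\pm1\}$ generated as follows: $y,\epsilon$ are independent and uniform on $\{\pm1\}$, and given $(y,\epsilon)$ the coordinates are independent with $x_1\sim\mathcal{N}\left(\frac{\mu_1-\mu_3}{2}+y\,\frac{\mu_1+\mu_3}{2},\sigma^2\right)$ and $x_2\sim\mathcal{N}\left(\mu_2\epsilon\,\frac{y+1}{2},\sigma^2\right)$. Let $U(\gamma)=\begin{bmatrix}\cos\gamma&-\sin\gamma\\ \sin\gamma&\cos\gamma\end{bmatrix}$. $\mathcal{D}^{(\gamma)}$ is the law of $(U(\gamma)x,y)$ for $(x,y)\sim\mathcal{D}$, i.e. $\mathcal{D}^{(\gamma)}((x,y))=\mathcal{D}((U(\gamma)^{\top}x,y))$. $\mathrm{ReLU}(z)=\max(0,z)$ is applied entrywise; $A_{k,:}$ is the $k$-th row of $A$. The (sub)gradient of the loss in row $w_k=W_{k,:}$ is taken to be $-a_k\,\mathbb{E}_{\mathcal{D}^{(\gamma)}}[y\,x\,\mathbf{1}\{\langle w_k,x\rangle\ge0\}]$, i.e. with the convention $\mathrm{ReLU}'(0)=1$ (this is the ordinary gradient whenever $w_k\ne0$).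
   Formalization: The rule lim sign(f(W_t;x)) = sign(x_1+x_2) is stated only for x_1+x_2 ≠ 0 and when some a_k equals sign(x_1+x_2): otherwise f(W_t;x) is eventually 0 (limit 0), and on x_1 = -x_2 it stays at f(W_0;x). *)

theory Defs
  imports "HOL-Probability.Probability"
begin

(* The second parameter is the standard deviation, not the variance. *)
abbreviation gaussian :: "real \<Rightarrow> real \<Rightarrow> real measure" where
  "gaussian m s \<equiv> density lborel (\<lambda>u. ennreal (normal_density m s u))"

abbreviation Phi :: "real \<Rightarrow> real" where
  "Phi \<equiv> cdf std_normal_distribution"

(* The law of (x, y) given the signs (y, e): independent coordinates, collected into a
   vector, together with the label y. *)
definition cond_dist ::
  "real \<Rightarrow> real \<Rightarrow> real \<Rightarrow> real \<Rightarrow> real \<times> real \<Rightarrow> ((real ^ 2) \<times> real) measure" where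
  "cond_dist mu1 mu2 mu3 s = (\<lambda>(y, e).
     distr (gaussian ((mu1 - mu3) / 2 + y * ((mu1 + mu3) / 2)) s
              \<Otimes>\<^sub>M gaussian (mu2 * e * ((y + 1) / 2)) s)
       borel (\<lambda>(u, v). (vector [u, v], y)))"

definition mixture ::
  "real \<Rightarrow> real \<Rightarrow> real \<Rightarrow> real \<Rightarrow> ((real ^ 2) \<times> real) measure" where
  "mixture mu1 mu2 mu3 s =
     measure_pmf (pair_pmf (pmf_of_set {-1, 1}) (pmf_of_set {-1, 1}))
       \<bind> cond_dist mu1 mu2 mu3 s"

definition rot :: "real \<Rightarrow> real ^ 2 ^ 2" where
  "rot g = vector [vector [cos g, - sin g], vector [sin g, cos g]]"

definition rotated ::
  "real \<Rightarrow> ((real ^ 2) \<times> real) measure \<Rightarrow> ((real ^ 2) \<times> real) measure" where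
  "rotated g D = distr D borel (\<lambda>(x, y). (rot g *v x, y))"

definition ReLU :: "real ^ 'm \<Rightarrow> real ^ 'm" where
  "ReLU z = (\<chi> k. max 0 (z $ k))"

definition network :: "real ^ 'm \<Rightarrow> real ^ 2 ^ 'm \<Rightarrow> real ^ 2 \<Rightarrow> real" where
  "network a W x = a \<bullet> ReLU (W *v x)"

definition loss ::
  "((real ^ 2) \<times> real) measure \<Rightarrow> real ^ 'm \<Rightarrow> real ^ 2 ^ 'm \<Rightarrow> real" where
  "loss D a W = (\<integral>(x, y). - y * network a W x \<partial>D)"

(* Row k is - a_k E[y x 1{<w_k, x> >= 0}], the expectation of the gradient of a single sample
   with the convention ReLU'(0) = 1. It is the gradient of the loss in row k whenever
   w_k is nonzero, see loss_grad_gradient below; at w_k = 0 the loss is in general not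
   differentiable and the formula is a convention. *)
definition loss_grad ::
  "((real ^ 2) \<times> real) measure \<Rightarrow> real ^ 'm \<Rightarrow> real ^ 2 ^ 'm \<Rightarrow> real ^ 2 ^ 'm" where
  "loss_grad D a W =
     (\<chi> k. - (a $ k *\<^sub>R (\<integral>(x, y). (y * of_bool (W $ k \<bullet> x \<ge> 0)) *\<^sub>R x \<partial>D)))"

definition sign_mat :: "real ^ 'n ^ 'm \<Rightarrow> real ^ 'n ^ 'm" where
  "sign_mat G = (\<chi> i j. sgn (G $ i $ j))"

(* The points at which the classification rule h is not locally constant. *)
definition decision_boundary :: "('a::topological_space \<Rightarrow> 'b) \<Rightarrow> 'a set" where
  "decision_boundary h = {x. \<not> (\<forall>\<^sub>F z in nhds x. h z = h x)}"

(* The facts below relate loss_grad to loss. *)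

lemma relu_remainder:
  fixes w v x :: "'a::real_inner"
  shows "\<bar>max 0 (v \<bullet> x) - max 0 (w \<bullet> x) - of_bool (w \<bullet> x \<ge> 0) * ((v - w) \<bullet> x)\<bar> \<le> norm x * norm (v - w)"
proof -
  have "\<bar>max 0 (v \<bullet> x) - max 0 (w \<bullet> x) - of_bool (w \<bullet> x \<ge> 0) * ((v - w) \<bullet> x)\<bar> \<le> \<bar>(v - w) \<bullet> x\<bar>"
    by (auto simp: inner_diff_left)
  also have "\<dots> \<le> norm (v - w) * norm x" by (rule Cauchy_Schwarz_ineq2)
  finally show ?thesis by (simp add: mult.commute)
qed

lemma gderiv_expected_relu:
  fixes D :: "((real ^ 2) \<times> real) measure"
  assumes [measurable_cong]: "sets D = sets borel"
    and int: "integrable D (\<lambda>z. snd z *\<^sub>R fst z)"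
    and ae: "AE z in D. w \<bullet> fst z \<noteq> 0"
  shows "GDERIV (\<lambda>v. \<integral>z. snd z * max 0 (v \<bullet> fst z) \<partial>D) w
           :> (\<integral>z. (snd z * of_bool (w \<bullet> fst z \<ge> 0)) *\<^sub>R fst z \<partial>D)"
proof -
  have [measurable]: "fst \<in> borel_measurable D" "snd \<in> borel_measurable D"
    by (auto simp: measurable_cong_sets[OF assms(1) refl] borel_prod[symmetric])
  have nint: "integrable D (\<lambda>z. \<bar>snd z\<bar> * norm (fst z))"
    using integrable_norm[OF int] by simp
  have i1: "integrable D (\<lambda>z. snd z * max 0 (v \<bullet> fst z))" for v
  proof (rule Bochner_Integration.integrable_bound[OF integrable_mult_right[OF nint, of "norm v"]])
    show "AE z in D. norm (snd z * max 0 (v \<bullet> fst z)) \<le> norm (norm v * (\<bar>snd z\<bar> * norm (fst z)))"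
    proof (rule AE_I2)
      fix z :: "(real ^ 2) \<times> real"
      have "\<bar>max 0 (v \<bullet> fst z)\<bar> \<le> norm v * norm (fst z)"
        using Cauchy_Schwarz_ineq2[of v "fst z"] by auto
      from mult_left_mono[OF this abs_ge_zero[of "snd z"]]
      show "norm (snd z * max 0 (v \<bullet> fst z)) \<le> norm (norm v * (\<bar>snd z\<bar> * norm (fst z)))"
        by (simp add: abs_mult mult_ac)
    qed
  qed measurable
  have i2: "integrable D (\<lambda>z. (snd z * of_bool (w \<bullet> fst z \<ge> 0)) *\<^sub>R fst z)"
    by (rule Bochner_Integration.integrable_bound[OF nint]) (auto simp: abs_mult)
  define r where "r = (\<lambda>v z. snd z * (max 0 (v \<bullet> fst z) - max 0 (w \<bullet> fst z)
      - of_bool (w \<bullet> fst z \<ge> 0) * ((v - w) \<bullet> fst z)) / norm (v - w))"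
  define G where "G = (\<integral>z. (snd z * of_bool (w \<bullet> fst z \<ge> 0)) *\<^sub>R fst z \<partial>D)"
  let ?F = "\<lambda>v. \<integral>z. snd z * max 0 (v \<bullet> fst z) \<partial>D"
  have eq: "((?F v - ?F w) - (v - w) \<bullet> G) /\<^sub>R norm (v - w) = (\<integral>z. r v z \<partial>D)" for v
  proof -
    have "(v - w) \<bullet> G = (\<integral>z. (v - w) \<bullet> ((snd z * of_bool (w \<bullet> fst z \<ge> 0)) *\<^sub>R fst z) \<partial>D)"
      unfolding G_def by (rule integral_inner_right[symmetric]) (use i2 in simp)
    moreover have "integrable D (\<lambda>z. (v - w) \<bullet> ((snd z * of_bool (w \<bullet> fst z \<ge> 0)) *\<^sub>R fst z))"
      using i2 by (rule integrable_inner_right)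
    ultimately have "(?F v - ?F w) - (v - w) \<bullet> G =
      (\<integral>z. snd z * max 0 (v \<bullet> fst z) - snd z * max 0 (w \<bullet> fst z)
         - (v - w) \<bullet> ((snd z * of_bool (w \<bullet> fst z \<ge> 0)) *\<^sub>R fst z) \<partial>D)"
      using i1 by (simp add: Bochner_Integration.integral_diff)
    then have "((?F v - ?F w) - (v - w) \<bullet> G) /\<^sub>R norm (v - w) =
       (\<integral>z. (snd z * max 0 (v \<bullet> fst z) - snd z * max 0 (w \<bullet> fst z)
         - (v - w) \<bullet> ((snd z * of_bool (w \<bullet> fst z \<ge> 0)) *\<^sub>R fst z)) / norm (v - w) \<partial>D)"
      by (simp add: field_simps)
    also have "\<dots> = (\<integral>z. r v z \<partial>D)"
      by (rule Bochner_Integration.integral_cong) (auto simp: r_def algebra_simps)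
    finally show ?thesis .
  qed
  have "((\<lambda>v. \<integral>z. r v z \<partial>D) \<longlongrightarrow> 0) (at w)"
    unfolding tendsto_at_iff_sequentially
  proof (intro allI impI)
    fix X assume X: "\<forall>i. X i \<in> UNIV - {w}" "X \<longlonglongrightarrow> w"
    have "(\<lambda>i. \<integral>z. r (X i) z \<partial>D) \<longlonglongrightarrow> (\<integral>z. 0 \<partial>D)"
    proof (rule integral_dominated_convergence[where w="\<lambda>z. \<bar>snd z\<bar> * norm (fst z)"])
      show "AE z in D. (\<lambda>i. r (X i) z) \<longlonglongrightarrow> 0"
        using ae
      proof eventually_elim
        case (elim z)
        have lim: "(\<lambda>i. X i \<bullet> fst z) \<longlonglongrightarrow> w \<bullet> fst z"
          using X(2) by (intro tendsto_intros)
        have "\<forall>\<^sub>F i in sequentially. r (X i) z = 0"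
        proof (cases "w \<bullet> fst z > 0")
          case True
          from order_tendstoD(1)[OF lim this] show ?thesis
            by eventually_elim (use True in \<open>auto simp: r_def inner_diff_left\<close>)
        next
          case False
          then have "w \<bullet> fst z < 0" using elim by simp
          from order_tendstoD(2)[OF lim this] show ?thesis
            by eventually_elim (use False elim in \<open>auto simp: r_def\<close>)
        qed
        then show ?case by (rule tendsto_eventually)
      qed
      show "AE z in D. norm (r (X i) z) \<le> \<bar>snd z\<bar> * norm (fst z)" for i
      proof (rule AE_I2)
        fix z
        have n: "norm (X i - w) > 0" using X(1) by auto
        have "norm (r (X i) z) = \<bar>snd z\<bar> * (\<bar>max 0 (X i \<bullet> fst z) - max 0 (w \<bullet> fst z)
           - of_bool (w \<bullet> fst z \<ge> 0) * ((X i - w) \<bullet> fst z)\<bar> / norm (X i - w))"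
          by (simp add: r_def abs_mult)
        also have "\<dots> \<le> \<bar>snd z\<bar> * norm (fst z)"
          by (intro mult_left_mono abs_ge_zero)
            (use n relu_remainder[of "X i" "fst z" w] in \<open>simp add: pos_divide_le_eq\<close>)
        finally show "norm (r (X i) z) \<le> \<bar>snd z\<bar> * norm (fst z)" .
      qed
      show "r (X i) \<in> borel_measurable D" for i
        unfolding r_def by measurable
    qed (use nint in simp_all)
    then show "((\<lambda>v. \<integral>z. r v z \<partial>D) \<circ> X) \<longlonglongrightarrow> 0" by (simp add: comp_def)
  qed
  then show ?thesis
    unfolding gderiv_def has_derivative_at_within G_def[symmetric]
    by (simp only: eq bounded_linear_inner_left simp_thms)
qed

lemma measurable_vector2 [measurable]:
  "(\<lambda>p. vector [fst p, snd p] :: real ^ 2) \<in> borel_measurable (borel \<Otimes>\<^sub>M borel)"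
proof (subst borel_measurable_euclidean_space, rule ballI)
  fix b :: "real ^ 2" assume "b \<in> Basis"
  then obtain i where b: "b = axis i 1" by (auto simp: Basis_vec_def)
  have "i = 1 \<or> i = 2" using exhaust_2 by blast
  then show "(\<lambda>p. (vector [fst p, snd p] :: real ^ 2) \<bullet> b) \<in> borel_measurable (borel \<Otimes>\<^sub>M borel)"
    by (auto simp: b inner_axis)
qed

lemma measurable_vector2_pair:
  "(\<lambda>(u, v). (vector [u, v] :: real ^ 2, y :: real)) \<in> borel_measurable (gaussian m s \<Otimes>\<^sub>M gaussian m' s)"
proof -
  have "(\<lambda>p. (vector [fst p, snd p] :: real ^ 2, y :: real)) \<in> borel_measurable (borel \<Otimes>\<^sub>M borel)"
    by (subst borel_prod[symmetric], measurable)
  then show ?thesis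
    by (simp add: case_prod_beta' cong: measurable_cong_sets sets_pair_measure_cong)
qed

lemma cond_dist_kernel:
  assumes "s > 0"
  shows "cond_dist mu1 mu2 mu3 s \<in> measurable (measure_pmf p) (subprob_algebra borel)"
proof -
  have "prob_space (cond_dist mu1 mu2 mu3 s ye)" for ye
    unfolding cond_dist_def case_prod_beta'
    by (intro prob_space.prob_space_distr prob_space_pair prob_space_normal_density assms
       measurable_vector2_pair[unfolded case_prod_beta'])
  then have "cond_dist mu1 mu2 mu3 s ye \<in> space (subprob_algebra borel)" for ye
    by (simp add: space_subprob_algebra prob_space_imp_subprob_space)
       (simp add: cond_dist_def case_prod_beta')
  then show ?thesis by simp
qed

lemma sets_mixture: "s > 0 \<Longrightarrow> sets (mixture mu1 mu2 mu3 s) = sets borel"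
  unfolding mixture_def by (rule sets_bind_measurable[OF cond_dist_kernel]) simp_all

lemma finite_signs: "finite (set_pmf (pair_pmf (pmf_of_set {-1, 1 :: real}) (pmf_of_set {-1, 1 :: real})))"
  by (simp add: set_pair_pmf)

lemma gaussian_abs_finite:
  assumes "s > 0"
  shows "(\<integral>\<^sup>+u. ennreal \<bar>u\<bar> \<partial>gaussian m s) < \<infinity>"
proof -
  have "integrable (gaussian m s) (\<lambda>u. u)"
    by (subst integrable_density) (use integrable_normal_moment_nz_1[OF assms] in auto)
  then show ?thesis by (simp add: integrable_iff_bounded)
qed

lemma integrable_mixture:
  assumes s: "s > 0"
  shows "integrable (mixture mu1 mu2 mu3 s) (\<lambda>z. snd z *\<^sub>R fst z)"
proof (rule integrableI_bounded)
  let ?f = "\<lambda>z :: (real ^ 2) \<times> real. ennreal (norm (snd z *\<^sub>R fst z))"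
  have m: "(\<lambda>z :: (real ^ 2) \<times> real. snd z *\<^sub>R fst z) \<in> borel_measurable borel"
    by (subst borel_prod[symmetric]) measurable
  then show "(\<lambda>z. snd z *\<^sub>R fst z) \<in> borel_measurable (mixture mu1 mu2 mu3 s)"
    by (simp add: measurable_cong_sets[OF sets_mixture[OF s] refl])
  have mf: "?f \<in> borel_measurable borel" using m by measurable
  have fin: "(\<integral>\<^sup>+z. ?f z \<partial>cond_dist mu1 mu2 mu3 s (y, e)) < \<infinity>" for y e
  proof -
    define A where "A = gaussian ((mu1 - mu3) / 2 + y * ((mu1 + mu3) / 2)) s"
    define B where "B = gaussian (mu2 * e * ((y + 1) / 2)) s"
    interpret A: prob_space A unfolding A_def by (rule prob_space_normal_density[OF s])
    interpret B: prob_space B unfolding B_def by (rule prob_space_normal_density[OF s])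
    have [measurable_cong]: "sets A = sets borel" "sets B = sets borel" by (auto simp: A_def B_def)
    have nb: "norm (vector [u, v] :: real ^ 2) \<le> \<bar>u\<bar> + \<bar>v\<bar>" for u v :: real
      using norm_le_l1_cart[of "vector [u, v] :: real ^ 2"] by (simp add: sum_2)
    have "(\<integral>\<^sup>+z. ?f z \<partial>cond_dist mu1 mu2 mu3 s (y, e)) =
       (\<integral>\<^sup>+p. ?f (vector [fst p, snd p], y) \<partial>(A \<Otimes>\<^sub>M B))"
      unfolding cond_dist_def case_prod_conv A_def B_def
      by (subst nn_integral_distr[OF measurable_vector2_pair])
         (use mf in \<open>auto simp: case_prod_beta'\<close>)
    also have "\<dots> \<le> (\<integral>\<^sup>+p. ennreal \<bar>y\<bar> * (ennreal \<bar>fst p\<bar> + ennreal \<bar>snd p\<bar>) \<partial>(A \<Otimes>\<^sub>M B))"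
      by (intro nn_integral_mono)
        (auto simp: ennreal_mult[symmetric] ennreal_plus[symmetric] simp del: ennreal_plus
          intro!: ennreal_leI mult_left_mono nb)
    also have "\<dots> = (\<integral>\<^sup>+u. \<integral>\<^sup>+v. ennreal \<bar>y\<bar> * (ennreal \<bar>u\<bar> + ennreal \<bar>v\<bar>) \<partial>B \<partial>A)"
      by (subst B.nn_integral_fst[symmetric]) simp_all
    also have "\<dots> = ennreal \<bar>y\<bar> * ((\<integral>\<^sup>+u. ennreal \<bar>u\<bar> \<partial>A) + (\<integral>\<^sup>+v. ennreal \<bar>v\<bar> \<partial>B))"
      by (simp add: nn_integral_cmult nn_integral_add A.emeasure_space_1 B.emeasure_space_1)
    also have "\<dots> < \<infinity>"
      using gaussian_abs_finite[OF s] by (simp add: A_def B_def ennreal_mult_less_top)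
    finally show ?thesis .
  qed
  show "(\<integral>\<^sup>+z. ?f z \<partial>mixture mu1 mu2 mu3 s) < \<infinity>"
    unfolding mixture_def nn_integral_bind[OF mf cond_dist_kernel[OF s]]
    by (subst nn_integral_measure_pmf_finite[OF finite_signs])
      (use fin in \<open>auto simp: finite_signs ennreal_mult_less_top simp del: set_pair_pmf\<close>)
qed

lemma AE_mixture:
  assumes s: "s > 0" and w: "w \<noteq> 0"
  shows "AE z in mixture mu1 mu2 mu3 s. w \<bullet> fst z \<noteq> 0"
proof -
  have P: "Measurable.pred borel (\<lambda>z :: (real ^ 2) \<times> real. w \<bullet> fst z \<noteq> 0)"
    by (subst borel_prod[symmetric]) measurable
  have "AE z in cond_dist mu1 mu2 mu3 s (y, e). w \<bullet> fst z \<noteq> 0" for y e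
  proof -
    define A where "A = gaussian ((mu1 - mu3) / 2 + y * ((mu1 + mu3) / 2)) s"
    define B where "B = gaussian (mu2 * e * ((y + 1) / 2)) s"
    interpret A: prob_space A unfolding A_def by (rule prob_space_normal_density[OF s])
    interpret B: prob_space B unfolding B_def by (rule prob_space_normal_density[OF s])
    interpret pair_prob_space A B ..
    have [measurable_cong]: "sets A = sets borel" "sets B = sets borel" by (auto simp: A_def B_def)
    have null: "AE u in gaussian m s. u \<noteq> t" for m t
      by (subst AE_density) (auto intro: AE_mp[OF AE_lborel_singleton])
    have "w $ 1 \<noteq> 0 \<or> w $ 2 \<noteq> 0"
      using w by (simp add: vec_eq_iff forall_2)
    then have "AE u in A. AE v in B. w $ 1 * u + w $ 2 * v \<noteq> 0"
    proof (cases "w $ 2 = 0")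
      case True
      then have w1: "w $ 1 \<noteq> 0" using \<open>w $ 1 \<noteq> 0 \<or> w $ 2 \<noteq> 0\<close> by simp
      have "AE u in A. u \<noteq> 0" unfolding A_def by (rule null)
      then show ?thesis by eventually_elim (simp add: True w1)
    next
      case False
      show ?thesis
      proof (rule AE_I2)
        fix u
        have "AE v in B. v \<noteq> - (w $ 1 * u) / w $ 2" unfolding B_def by (rule null)
        then show "AE v in B. w $ 1 * u + w $ 2 * v \<noteq> 0"
          by eventually_elim (use False in \<open>auto simp: field_simps add_eq_0_iff\<close>)
      qed
    qed
    then have "AE p in A \<Otimes>\<^sub>M B. w $ 1 * fst p + w $ 2 * snd p \<noteq> 0"
      by (intro AE_pair_measure) simp_all
    then show ?thesis
      unfolding cond_dist_def case_prod_conv A_def B_def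
      by (subst AE_distr_iff[OF measurable_vector2_pair])
         (use P in \<open>auto simp: pred_def case_prod_beta' inner_vec_def sum_2\<close>)
  qed
  then show ?thesis
    unfolding mixture_def AE_bind[OF cond_dist_kernel[OF s] P]
    by (intro AE_pmfI) (auto simp: split_paired_all)
qed

lemma measurable_rot:
  "(\<lambda>(x, y). (rot g *v x, y)) \<in> borel_measurable (borel :: ((real ^ 2) \<times> real) measure)"
  by (intro borel_measurable_continuous_onI)
     (auto simp: case_prod_beta' intro!: continuous_intros
        linear_continuous_on_compose[OF _ matrix_vector_mul_linear])

lemma inner_rot: "w \<bullet> (rot g *v x) = (transpose (rot g) *v w) \<bullet> x"
  by (simp add: dot_lmul_matrix transpose_matrix_vector)

lemma rot_transpose_nonzero:
  assumes "w \<noteq> 0" shows "transpose (rot g) *v w \<noteq> 0"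
proof
  assume "transpose (rot g) *v w = 0"
  then have "(transpose (rot g) *v w) \<bullet> (transpose (rot g) *v w) = 0" by simp
  moreover have "(transpose (rot g) *v w) \<bullet> (transpose (rot g) *v w) = ((sin g)\<^sup>2 + (cos g)\<^sup>2) * (w \<bullet> w)"
    unfolding power2_eq_square
    by (simp add: inner_vec_def matrix_vector_mult_def transpose_def rot_def sum_2) algebra
  ultimately show False using assms by simp
qed

lemma loss_grad_gradient:
  assumes s: "s > 0" and D: "D = rotated g (mixture mu1 mu2 mu3 s)" and w: "W $ k \<noteq> 0"
  shows "GDERIV (\<lambda>v. loss D a (\<chi> j. if j = k then v else W $ j)) (W $ k) :> loss_grad D a W $ k"
proof -
  let ?M = "mixture mu1 mu2 mu3 s"
  have mr: "(\<lambda>(x, y). (rot g *v x, y)) \<in> measurable ?M borel"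
    using measurable_rot by (simp add: measurable_cong_sets[OF sets_mixture[OF s] refl])
  have setsD: "sets D = sets borel" by (simp add: D rotated_def)
  have mD: "(\<lambda>z :: (real ^ 2) \<times> real. snd z *\<^sub>R fst z) \<in> borel_measurable borel"
    by (subst borel_prod[symmetric]) measurable
  have intD: "integrable D (\<lambda>z. snd z *\<^sub>R fst z)"
  proof -
    have "integrable ?M (\<lambda>z. rot g *v (snd z *\<^sub>R fst z))"
      by (rule integrable_bounded_linear[OF matrix_vector_mul_bounded_linear integrable_mixture[OF s]])
    then show ?thesis
      unfolding D rotated_def
      by (subst integrable_distr_eq[OF mr mD]) (simp add: case_prod_beta' matrix_vector_mult_scaleR)
  qed
  have aeD: "AE z in D. v \<bullet> fst z \<noteq> 0" if "v \<noteq> 0" for v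
  proof -
    have P: "Measurable.pred borel (\<lambda>z :: (real ^ 2) \<times> real. v \<bullet> fst z \<noteq> 0)"
      by (subst borel_prod[symmetric]) measurable
    show ?thesis
      unfolding D rotated_def
      by (subst AE_distr_iff[OF mr])
        (use P AE_mixture[OF s rot_transpose_nonzero[OF that]] in
          \<open>auto simp: pred_def case_prod_beta' inner_rot\<close>)
  qed
  have i: "integrable D (\<lambda>z. snd z * max 0 (v \<bullet> fst z))" for v
  proof (rule Bochner_Integration.integrable_bound[OF integrable_mult_right[OF integrable_norm[OF intD], of "norm v"]])
    have "(\<lambda>z. snd z * max 0 (v \<bullet> fst z)) \<in> borel_measurable (borel :: ((real ^ 2) \<times> real) measure)"
      by (subst borel_prod[symmetric]) measurable
    then show "(\<lambda>z. snd z * max 0 (v \<bullet> fst z)) \<in> borel_measurable D"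
      by (simp add: measurable_cong_sets[OF setsD refl])
    show "AE z in D. norm (snd z * max 0 (v \<bullet> fst z)) \<le> norm (norm v * norm (snd z *\<^sub>R fst z))"
    proof (rule AE_I2)
      fix z :: "(real ^ 2) \<times> real"
      have "\<bar>max 0 (v \<bullet> fst z)\<bar> \<le> norm v * norm (fst z)"
        using Cauchy_Schwarz_ineq2[of v "fst z"] by auto
      from mult_left_mono[OF this abs_ge_zero[of "snd z"]]
      show "norm (snd z * max 0 (v \<bullet> fst z)) \<le> norm (norm v * norm (snd z *\<^sub>R fst z))"
        by (simp add: abs_mult mult_ac)
    qed
  qed
  define F where "F = (\<lambda>v. \<integral>z. snd z * max 0 (v \<bullet> fst z) \<partial>D)"
  have loss_eq: "loss D a V = - (\<Sum>j\<in>UNIV. a $ j * F (V $ j))" for V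
  proof -
    have "loss D a V = (\<integral>z. - (\<Sum>j\<in>UNIV. a $ j * (snd z * max 0 (V $ j \<bullet> fst z))) \<partial>D)"
      unfolding loss_def network_def ReLU_def inner_vec_def
      by (rule Bochner_Integration.integral_cong)
        (auto simp: matrix_vector_mult_def inner_vec_def sum_distrib_left sum_negf[symmetric] mult_ac)
    also have "\<dots> = - (\<Sum>j\<in>UNIV. a $ j * F (V $ j))"
      unfolding F_def using i by simp
    finally show ?thesis .
  qed
  have rows: "loss D a (\<chi> j. if j = k then v else W $ j)
       = - (a $ k * F v) - (\<Sum>j\<in>UNIV - {k}. a $ j * F (W $ j))" for v
    unfolding loss_eq by (subst sum.remove[of _ k]) auto
  have "GDERIV F (W $ k) :> (\<integral>z. (snd z * of_bool (W $ k \<bullet> fst z \<ge> 0)) *\<^sub>R fst z \<partial>D)"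
    unfolding F_def by (rule gderiv_expected_relu[OF setsD intD aeD[OF w]])
  then show ?thesis
    unfolding gderiv_def rows loss_grad_def
    by (auto intro!: derivative_eq_intros simp: case_prod_beta')
qed

end

theory Submission
  imports Defs
begin

text \<open>
  For x \<sim> N(m, s^2 I) and unit vectors u, v, the half-plane moment E[(u \<bullet> x) 1{v \<bullet> x \<ge> 0}] equals
  (u \<bullet> m) Phi(v \<bullet> m / s) + s (u \<bullet> v) phi(v \<bullet> m / s). Undoing the rotation, the components of
  E[y x 1{w \<bullet> x \<ge> 0}] become the components of the corresponding mixture moment along the
  directions (cos \<gamma>, - sin \<gamma>) and (sin \<gamma>, cos \<gamma>). Along each of them the first coordinate is at
  least sin \<gamma> and the second at most cos \<gamma> in absolute value, and under the noise condition
  the first coordinate outweighs the second one and the density terms. So both components are positive for every w,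
  zero included: each sign step moves row k by \<eta> a_k (1, 1), and after t steps the row is
  w_k(0) + t \<eta> a_k (1, 1).
\<close>

section \<open>Gaussian products: affine images, projections and half-planes\<close>

lemma gaussian_affine:
  assumes "s \<noteq> 0"
  shows "gaussian m \<bar>s\<bar> = distr std_normal_distribution borel (\<lambda>z. m + s * z)"
proof -
  interpret N: prob_space std_normal_distribution by (rule prob_space_normal_density) simp
  have "distributed std_normal_distribution lborel (\<lambda>z. z) std_normal_density"
    by (auto simp: distributed_def distr_id2)
  from N.normal_density_affine[OF this _ , of s m] assms
  have "distributed std_normal_distribution lborel (\<lambda>z. m + z * s) (normal_density m \<bar>s\<bar>)"
    by (simp add: mult.commute)
  then show ?thesis
    by (simp add: distributed_def mult.commute[of s] cong: distr_cong)
qed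

lemma sets_gaussian_pair [measurable_cong]:
  "sets (gaussian m s \<Otimes>\<^sub>M gaussian m' s') = sets (borel \<Otimes>\<^sub>M borel)"
  by (intro sets_pair_measure_cong) auto

lemma gaussian_pair_affine:
  assumes "s > 0"
  shows "gaussian m s \<Otimes>\<^sub>M gaussian m' s =
    distr (std_normal_distribution \<Otimes>\<^sub>M std_normal_distribution) (borel \<Otimes>\<^sub>M borel)
      (\<lambda>(x, y). (m + s * x, m' + s * y))"
proof -
  have aff: "gaussian m s = distr std_normal_distribution borel (\<lambda>z. m + s * z)" for m
    using gaussian_affine[of s m] assms by simp
  have "sigma_finite_measure (distr std_normal_distribution borel (\<lambda>z. m' + s * z))"
    unfolding aff[symmetric]
    by (intro prob_space_imp_sigma_finite prob_space_normal_density assms)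
  then show ?thesis
    unfolding aff by (intro pair_measure_distr) auto
qed

text \<open>Rotation invariance of the planar standard Gaussian, via characteristic functions: the
  factors of the independent summands multiply to \<open>exp (- (v1^2 + v2^2) * t^2 / 2)\<close>,
  and Levy uniqueness concludes.\<close>

lemma std_normal_pair_projection:
  assumes v: "v1\<^sup>2 + v2\<^sup>2 = 1"
  shows "distr (std_normal_distribution \<Otimes>\<^sub>M std_normal_distribution) borel (\<lambda>z. v1 * fst z + v2 * snd z)
    = std_normal_distribution" (is "distr ?P borel ?X = ?N")
proof -
  interpret N: real_distribution ?N by (rule real_dist_normal_dist)
  interpret P: pair_prob_space ?N ?N ..
  have char1: "char (distr ?N borel (\<lambda>z. c * z)) t = exp (- (c\<^sup>2 * t\<^sup>2) / 2)" for c t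
  proof -
    have "char (distr ?N borel (\<lambda>z. c * z)) t = char ?N (c * t)"
      unfolding char_def by (subst integral_distr) (simp_all add: mult_ac)
    then show ?thesis by (simp add: char_std_normal_distribution power_mult_distrib)
  qed
  have fst: "distr ?P borel (\<lambda>z. c * fst z) = distr ?N borel (\<lambda>z. c * z)" for c
  proof -
    have "distr ?N borel (\<lambda>z. c * z) = distr (distr ?P ?N fst) borel (\<lambda>z. c * z)"
      by (simp add: N.distr_pair_fst)
    also have "\<dots> = distr ?P borel (\<lambda>z. c * fst z)"
      by (subst distr_distr) (auto simp: comp_def)
    finally show ?thesis ..
  qed
  have snd: "distr ?P borel (\<lambda>z. c * snd z) = distr ?N borel (\<lambda>z. c * z)" for c
  proof -
    have "distr ?P ?N snd = distr (distr ?P ?P (\<lambda>(x, y). (y, x))) ?N fst"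
      by (subst distr_distr) (auto simp: comp_def case_prod_beta')
    then have "distr ?P ?N snd = ?N"
      by (simp add: P.distr_pair_swap[symmetric] N.distr_pair_fst)
    then have "distr ?N borel (\<lambda>z. c * z) = distr (distr ?P ?N snd) borel (\<lambda>z. c * z)"
      by simp
    also have "\<dots> = distr ?P borel (\<lambda>z. c * snd z)"
      by (subst distr_distr) (auto simp: comp_def)
    finally show ?thesis ..
  qed
  have indep: "P.indep_var borel (\<lambda>z. v1 * fst z) borel (\<lambda>z. v2 * snd z)"
  proof -
    have "sigma_finite_measure (distr ?N borel (\<lambda>z. v2 * z))"
      by (intro prob_space_imp_sigma_finite N.prob_space_distr) auto
    then show ?thesis
      unfolding P.indep_var_distribution_eq fst snd
      by (auto simp: pair_measure_distr case_prod_beta')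
  qed
  have "char (distr ?P borel ?X) t = char ?N t" for t
  proof -
    have "char (distr ?P borel ?X) t = exp (- (v1\<^sup>2 * t\<^sup>2) / 2) * exp (- (v2\<^sup>2 * t\<^sup>2) / 2)"
      by (simp add: P.char_distr_add[OF indep] fst snd char1)
    also have "\<dots> = exp (- ((v1\<^sup>2 + v2\<^sup>2) * t\<^sup>2) / 2)"
      unfolding of_real_mult[symmetric] exp_add[symmetric] by (simp add: field_simps)
    finally show ?thesis by (simp add: v char_std_normal_distribution)
  qed
  then have "char (distr ?P borel ?X) = char ?N" by (rule ext)
  moreover have "real_distribution (distr ?P borel ?X)"
    by (intro P.real_distribution_distr) auto
  ultimately show ?thesis by (intro Levy_uniqueness real_dist_normal_dist)
qed

lemma std_normal_pair_halfplane:
  assumes "v1\<^sup>2 + v2\<^sup>2 = 1"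
  shows "measure (std_normal_distribution \<Otimes>\<^sub>M std_normal_distribution)
    {z. 0 \<le> t + v1 * fst z + v2 * snd z} = Phi t" (is "measure ?P _ = _")
proof -
  \<comment> \<open>Projecting on \<open>(- v1, - v2)\<close>, again a unit vector, turns the
    half-plane into the event that the projection is at most \<open>t\<close>, which is the form of
    a distribution function.\<close>
  have "Phi t = measure (distr ?P borel (\<lambda>z. - v1 * fst z + - v2 * snd z)) {..t}"
    using assms by (subst std_normal_pair_projection) (simp_all add: cdf_def)
  also have "\<dots> = measure ?P {z. 0 \<le> t + v1 * fst z + v2 * snd z}"
    by (subst measure_distr) (auto simp: space_pair_measure algebra_simps vimage_def intro!: arg_cong[where f="measure ?P"])
  finally show ?thesis ..
qed

text \<open>The half-planes on either side of the vertical axis cover the plane and each has mass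
  \<open>Phi 0\<close>, so \<open>1 \<le> 2 * Phi 0\<close>; monotonicity does the rest.\<close>

lemma Phi_ge_half:
  assumes "0 \<le> t" shows "1 / 2 \<le> Phi t"
proof -
  interpret N: real_distribution std_normal_distribution by (rule real_dist_normal_dist)
  let ?P = "std_normal_distribution \<Otimes>\<^sub>M std_normal_distribution"
  interpret P: pair_prob_space std_normal_distribution std_normal_distribution ..
  have m: "{z. 0 \<le> c * fst z} \<in> P.events" for c :: real
  proof -
    have "{z \<in> space (borel \<Otimes>\<^sub>M borel :: (real \<times> real) measure). 0 \<le> c * fst z} \<in> sets (borel \<Otimes>\<^sub>M borel)"
      by measurable
    then show ?thesis by (simp add: sets_gaussian_pair space_pair_measure)
  qed
  have "1 = measure ?P ({z. 0 \<le> 1 * fst z} \<union> {z. 0 \<le> - 1 * fst z})"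
  proof -
    have "{z. 0 \<le> 1 * fst z} \<union> {z. 0 \<le> - 1 * fst z} = space ?P" by (auto simp: space_pair_measure)
    then show ?thesis using P.prob_space by simp
  qed
  also have "\<dots> \<le> Phi 0 + Phi 0"
    using measure_Un_le[OF m m, of 1 "- 1"]
      std_normal_pair_halfplane[of 1 0 0] std_normal_pair_halfplane[of "- 1" 0 0]
    by simp
  finally show ?thesis using N.cdf_nondecreasing[OF assms] by simp
qed

section \<open>First moments of the Gaussian over half-lines and half-planes\<close>

lemma std_normal_tail_moment:
  "(\<integral>z. z * of_bool (a \<le> z) \<partial>std_normal_distribution) = std_normal_density a"
proof -
  let ?f = "\<lambda>z. z * std_normal_density z"
  have "(\<integral>z. z * of_bool (a \<le> z) \<partial>std_normal_distribution) = (LBINT z. indicator {a<..} z *\<^sub>R ?f z)"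
  proof -
    have "(\<integral>z. z * of_bool (a \<le> z) \<partial>std_normal_distribution) =
        (LBINT z. std_normal_density z *\<^sub>R (z * of_bool (a \<le> z)))"
      by (rule integral_density) auto
    \<comment> \<open>The endpoint \<open>a\<close> is dropped as a null set, since the interval
      integral used next runs over an open interval.\<close>
    also have "\<dots> = (LBINT z. indicator {a<..} z *\<^sub>R ?f z)"
    proof (rule integral_cong_AE)
      show "AE z in lborel. std_normal_density z *\<^sub>R (z * of_bool (a \<le> z)) = indicator {a<..} z *\<^sub>R ?f z"
        using AE_lborel_singleton[of a] by eventually_elim (auto simp: indicator_def)
    qed auto
    finally show ?thesis .
  qed
  also have "\<dots> = (LBINT z=ereal a..\<infinity>. ?f z)"
    by (simp add: interval_integral_to_infinity_eq set_lebesgue_integral_def)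
  \<comment> \<open>The negated density is an antiderivative of \<open>?f\<close> and vanishes at
    infinity, so only the endpoint \<open>a\<close> contributes.\<close>
  also have "\<dots> = 0 - (- std_normal_density a)"
  proof (rule interval_integral_FTC_integrable[where F = "\<lambda>z. - std_normal_density z"])
    show "((\<lambda>z. - std_normal_density z) has_vector_derivative ?f x) (at x)" for x
    proof -
      have "((\<lambda>z. - (k * exp (- z\<^sup>2 / 2))) has_real_derivative x * (k * exp (- x\<^sup>2 / 2))) (at x)" for k
        by (auto intro!: derivative_eq_intros)
      then show ?thesis
        unfolding std_normal_density_def has_real_derivative_iff_has_vector_derivative[symmetric] .
    qed
    show "isCont ?f x" for x
      unfolding std_normal_density_def by (intro continuous_intros) auto
    have "integrable lborel ?f"
      using integrable_std_normal_moment[of 1] by (simp add: mult.commute)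
    then show "set_integrable lborel (einterval (ereal a) \<infinity>) ?f"
      unfolding set_integrable_def by (intro integrable_mult_indicator) auto
    have "isCont (\<lambda>z. - std_normal_density z) a"
      unfolding std_normal_density_def by (intro continuous_intros) auto
    then show "(((\<lambda>z. - std_normal_density z) \<circ> real_of_ereal) \<longlongrightarrow> - std_normal_density a) (at_right (ereal a))"
      by (simp add: ereal_tendsto_simps isCont_def filterlim_at_split)
    have "filterlim (\<lambda>z :: real. - (z\<^sup>2 * (1 / 2))) at_bot at_top"
      by (intro filterlim_uminus_at_top[THEN iffD1] filterlim_at_top_mult_tendsto_pos[OF tendsto_const]
          filterlim_pow_at_top filterlim_ident) auto
    then have "((\<lambda>z. exp (- (z\<^sup>2 * (1 / 2))) :: real) \<longlongrightarrow> 0) at_top"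
      by (rule filterlim_compose[OF exp_at_bot])
    then have "((\<lambda>z. - (1 / sqrt (2 * pi) * exp (- (z\<^sup>2 * (1 / 2))))) \<longlongrightarrow> - (1 / sqrt (2 * pi) * 0)) at_top"
      by (intro tendsto_intros)
    then have "((\<lambda>z. - std_normal_density z) \<longlongrightarrow> 0) at_top"
      by (simp add: std_normal_density_def)
    then show "(((\<lambda>z. - std_normal_density z) \<circ> real_of_ereal) \<longlongrightarrow> 0) (at_left \<infinity>)"
      by (simp add: ereal_tendsto_simps)
  qed simp
  finally show ?thesis by simp
qed

lemma std_normal_half_line_moment:
  assumes "v \<noteq> 0"
  shows "(\<integral>z. z * of_bool (0 \<le> t + v * z) \<partial>std_normal_distribution) = sgn v * std_normal_density (t / v)"
proof (cases "v > 0")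
  case True
  then have "0 \<le> t + v * z \<longleftrightarrow> - t / v \<le> z" for z
    by (simp add: field_simps) linarith
  then show ?thesis
    using True std_normal_tail_moment[of "- t / v"] by (simp add: normal_density_def)
next
  case False
  then have v: "v < 0" using assms by simp
  then have iff: "0 \<le> t + v * - z \<longleftrightarrow> t / v \<le> z" for z
    by (simp add: field_simps)
  \<comment> \<open>Scale \<open>- 1\<close> in \<open>gaussian_affine\<close> gives invariance
    under reflection, which carries a lower tail to an upper tail.\<close>
  have "distr std_normal_distribution borel uminus = std_normal_distribution"
    using gaussian_affine[of "- 1" 0] by simp
  then have "(\<integral>z. z * of_bool (0 \<le> t + v * z) \<partial>std_normal_distribution) =
    (\<integral>z. z * of_bool (0 \<le> t + v * z) \<partial>distr std_normal_distribution borel uminus)" by simp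
  also have "\<dots> = (\<integral>z. - z * of_bool (0 \<le> t + v * - z) \<partial>std_normal_distribution)"
    by (subst integral_distr) auto
  finally show ?thesis
    using v std_normal_tail_moment[of "t / v"] by (simp only: iff) simp
qed

text \<open>Completing the square in \<open>z\<close>: the exponents satisfy
  \<open>z^2 + ((t + v2 * z) / v1)^2 = t^2 + (z + t * v2)^2 / v1^2\<close>. In the iterated integral
  for the half-plane moment this leaves a constant times a probability density in
  \<open>z\<close>.\<close>

lemma std_normal_complete_square:
  fixes v1 v2 t z :: real
  assumes v: "v1\<^sup>2 + v2\<^sup>2 = 1" and "v1 \<noteq> 0"
  shows "std_normal_density z * std_normal_density ((t + v2 * z) / v1) =
    \<bar>v1\<bar> * std_normal_density t * normal_density (- (t * v2)) \<bar>v1\<bar> z"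
proof -
  have v2: "v2\<^sup>2 = 1 - v1\<^sup>2" using v by simp
  have "z\<^sup>2 + ((t + v2 * z) / v1)\<^sup>2 = t\<^sup>2 + (z + t * v2)\<^sup>2 / v1\<^sup>2"
    using assms(2) by (simp add: field_simps power2_sum power_mult_distrib v2) 
  then have "- z\<^sup>2 / 2 + - ((t + v2 * z) / v1)\<^sup>2 / 2 = - t\<^sup>2 / 2 + - (z - - (t * v2))\<^sup>2 / (2 * \<bar>v1\<bar>\<^sup>2)"
    by simp
  then have "exp (- z\<^sup>2 / 2) * exp (- ((t + v2 * z) / v1)\<^sup>2 / 2) = exp (- t\<^sup>2 / 2) * exp (- (z - - (t * v2))\<^sup>2 / (2 * \<bar>v1\<bar>\<^sup>2))"
    unfolding exp_add[symmetric] by simp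
  then show ?thesis
    using assms(2) by (simp add: normal_density_def real_sqrt_mult)
qed

lemma integrable_std_normal_pair:
  "integrable (std_normal_distribution \<Otimes>\<^sub>M std_normal_distribution) fst"
  "integrable (std_normal_distribution \<Otimes>\<^sub>M std_normal_distribution) snd"
proof -
  let ?N = std_normal_distribution
  interpret N: real_distribution ?N by (rule real_dist_normal_dist)
  interpret P: pair_prob_space ?N ?N ..
  have "integrable (distr (?N \<Otimes>\<^sub>M ?N) ?N fst) (\<lambda>x. x)"
    using integrable_std_normal_distribution_moment[of 1] by (simp add: N.distr_pair_fst)
  then show fst: "integrable (?N \<Otimes>\<^sub>M ?N) fst"
    by (simp add: integrable_distr_eq)
  show "integrable (?N \<Otimes>\<^sub>M ?N) snd"
    using P.integrable_product_swap[OF fst] by (simp add: case_prod_beta')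
qed

lemma integrable_mult_of_bool:
  fixes f :: "'a \<Rightarrow> real"
  assumes "integrable M f" and [measurable]: "Measurable.pred M P"
  shows "integrable M (\<lambda>x. f x * of_bool (P x))"
proof -
  have "f \<in> borel_measurable M" using assms(1) by simp
  then show ?thesis
    by (intro Bochner_Integration.integrable_bound[OF assms(1)]) auto
qed

text \<open>Fubini with the first coordinate inside: the half-line moment evaluates the inner
  integral, and completing the square turns the outer integrand into
  \<open>v1 * std_normal_density t\<close> times a normal density.\<close>

lemma std_normal_pair_halfplane_moment_fst:
  assumes v: "v1\<^sup>2 + v2\<^sup>2 = 1"
  shows "(\<integral>z. fst z * of_bool (0 \<le> t + v1 * fst z + v2 * snd z)
      \<partial>(std_normal_distribution \<Otimes>\<^sub>M std_normal_distribution)) = v1 * std_normal_density t"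
proof -
  let ?N = std_normal_distribution
  interpret N: real_distribution ?N by (rule real_dist_normal_dist)
  interpret P: pair_prob_space ?N ?N ..
  let ?f = "\<lambda>x y. x * of_bool (0 \<le> t + v1 * x + v2 * y)"
  have "integrable (?N \<Otimes>\<^sub>M ?N) (\<lambda>z. fst z * of_bool (0 \<le> t + v1 * fst z + v2 * snd z))"
    by (intro integrable_mult_of_bool integrable_std_normal_pair) measurable
  then have "(\<integral>z. fst z * of_bool (0 \<le> t + v1 * fst z + v2 * snd z) \<partial>(?N \<Otimes>\<^sub>M ?N)) =
      (\<integral>y. (\<integral>x. ?f x y \<partial>?N) \<partial>?N)"
    using P.integral_snd[of ?f] by (simp add: case_prod_beta')
  also have "\<dots> = v1 * std_normal_density t"
  proof (cases "v1 = 0")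
    \<comment> \<open>The indicator no longer depends on the inner variable, so the inner integral
      is a multiple of the zero mean.\<close>
    case True
    have "(\<integral>x. x \<partial>?N) = 0"
      using integral_std_normal_distribution_moment_odd[of 1] by simp
    with True show ?thesis by simp
  next
    case False
    have "(\<integral>x. ?f x y \<partial>?N) = sgn v1 * std_normal_density ((t + v2 * y) / v1)" for y
      using std_normal_half_line_moment[OF False, of "t + v2 * y"] by (simp add: add_ac)
    then have "(\<integral>y. (\<integral>x. ?f x y \<partial>?N) \<partial>?N) =
        (LBINT y. std_normal_density y *\<^sub>R (sgn v1 * std_normal_density ((t + v2 * y) / v1)))"
      by (simp only:) (rule integral_density, auto)
    also have "\<dots> = (LBINT y. v1 * std_normal_density t * normal_density (- (t * v2)) \<bar>v1\<bar> y)"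
    proof (rule Bochner_Integration.integral_cong)
      fix y
      have "std_normal_density y *\<^sub>R (sgn v1 * std_normal_density ((t + v2 * y) / v1)) =
          sgn v1 * (std_normal_density y * std_normal_density ((t + v2 * y) / v1))"
        by simp
      also have "\<dots> = v1 * std_normal_density t * normal_density (- (t * v2)) \<bar>v1\<bar> y"
        unfolding std_normal_complete_square[OF v False]
        by (simp add: mult.assoc[symmetric] sgn_mult_abs)
      finally show "std_normal_density y *\<^sub>R (sgn v1 * std_normal_density ((t + v2 * y) / v1)) =
        v1 * std_normal_density t * normal_density (- (t * v2)) \<bar>v1\<bar> y" .
    qed simp
    also have "\<dots> = v1 * std_normal_density t"
      using False by simp
    finally show ?thesis .
  qed
  finally show ?thesis .
qed

lemma std_normal_pair_halfplane_moment_snd: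
  assumes v: "v1\<^sup>2 + v2\<^sup>2 = 1"
  shows "(\<integral>z. snd z * of_bool (0 \<le> t + v1 * fst z + v2 * snd z)
      \<partial>(std_normal_distribution \<Otimes>\<^sub>M std_normal_distribution)) = v2 * std_normal_density t"
proof -
  let ?N = std_normal_distribution
  interpret N: real_distribution ?N by (rule real_dist_normal_dist)
  interpret P: pair_prob_space ?N ?N ..
  have "(\<integral>z. snd z * of_bool (0 \<le> t + v1 * fst z + v2 * snd z) \<partial>(?N \<Otimes>\<^sub>M ?N)) =
      (\<integral>z. snd z * of_bool (0 \<le> t + v1 * fst z + v2 * snd z)
        \<partial>distr (?N \<Otimes>\<^sub>M ?N) (?N \<Otimes>\<^sub>M ?N) (\<lambda>(x, y). (y, x)))"
    by (simp add: P.distr_pair_swap[symmetric])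
  also have "\<dots> = (\<integral>z. fst z * of_bool (0 \<le> t + v2 * fst z + v1 * snd z) \<partial>(?N \<Otimes>\<^sub>M ?N))"
    by (subst integral_distr) (auto simp: case_prod_beta' algebra_simps)
  also have "\<dots> = v2 * std_normal_density t"
    using v by (intro std_normal_pair_halfplane_moment_fst) simp
  finally show ?thesis .
qed

text \<open>Standardising each coordinate moves the boundary line to signed offset \<open>t\<close>,
  the distance of the mean from the line in units of \<open>s\<close>. The mean then contributes the
  mass of the half-plane, the fluctuation the two standard first moments.\<close>

lemma gaussian_pair_halfplane_moment:
  assumes s: "s > 0" and v: "v1\<^sup>2 + v2\<^sup>2 = 1"
  shows "(\<integral>z. (u1 * fst z + u2 * snd z) * of_bool (0 \<le> v1 * fst z + v2 * snd z)
      \<partial>(gaussian m1 s \<Otimes>\<^sub>M gaussian m2 s)) =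
    (u1 * m1 + u2 * m2) * Phi ((v1 * m1 + v2 * m2) / s) +
    s * (u1 * v1 + u2 * v2) * std_normal_density ((v1 * m1 + v2 * m2) / s)"
proof -
  let ?N = std_normal_distribution
  let ?P = "?N \<Otimes>\<^sub>M ?N"
  interpret N: real_distribution ?N by (rule real_dist_normal_dist)
  interpret P: pair_prob_space ?N ?N ..
  define t where "t = (v1 * m1 + v2 * m2) / s"
  define h where "h = (\<lambda>z :: real \<times> real. 0 \<le> t + v1 * fst z + v2 * snd z)"
  have [measurable]: "Measurable.pred ?P h" unfolding h_def by measurable
  have h: "0 \<le> v1 * (m1 + s * x) + v2 * (m2 + s * y) \<longleftrightarrow> h (x, y)" for x y
  proof -
    have "v1 * (m1 + s * x) + v2 * (m2 + s * y) = s * (t + v1 * x + v2 * y)"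
      using s by (simp add: t_def field_simps)
    then show ?thesis using s by (simp add: h_def zero_le_mult_iff)
  qed
  have "(\<integral>z. of_bool (h z) \<partial>?P) = (\<integral>z. indicator {z. h z} z \<partial>?P)"
    by (simp add: indicator_def)
  also have "\<dots> = measure ?P {z. h z}"
    by (subst Bochner_Integration.integral_indicator) (auto simp: space_pair_measure)
  finally have P1: "(\<integral>z. of_bool (h z) \<partial>?P) = Phi t"
    using std_normal_pair_halfplane[OF v] by (simp add: h_def)
  have [simp]: "integrable ?P (\<lambda>z. fst z * of_bool (h z))" "integrable ?P (\<lambda>z. snd z * of_bool (h z))"
    by (intro integrable_mult_of_bool integrable_std_normal_pair; measurable)+
  have [simp]: "integrable ?P (\<lambda>z. of_bool (h z) :: real)"
    using integrable_mult_of_bool[of ?P "\<lambda>_. 1" h] by simp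
  have "(\<integral>z. (u1 * fst z + u2 * snd z) * of_bool (0 \<le> v1 * fst z + v2 * snd z)
      \<partial>(gaussian m1 s \<Otimes>\<^sub>M gaussian m2 s)) =
    (\<integral>z. (u1 * (m1 + s * fst z) + u2 * (m2 + s * snd z)) * of_bool (h z) \<partial>?P)"
    unfolding gaussian_pair_affine[OF s]
    by (subst integral_distr) (simp_all add: case_prod_beta' h)
  also have "\<dots> = (\<integral>z. (u1 * m1 + u2 * m2) * of_bool (h z) + s * u1 * (fst z * of_bool (h z))
      + s * u2 * (snd z * of_bool (h z)) \<partial>?P)"
    by (intro Bochner_Integration.integral_cong) (auto simp: algebra_simps)
  also have "\<dots> = (u1 * m1 + u2 * m2) * Phi t + s * u1 * (v1 * std_normal_density t)
      + s * u2 * (v2 * std_normal_density t)"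
    using std_normal_pair_halfplane_moment_fst[OF v, of t] std_normal_pair_halfplane_moment_snd[OF v, of t]
    by (simp add: P1) (simp add: h_def)
  finally show ?thesis by (simp add: t_def algebra_simps)
qed

section \<open>Expectations under the mixture and the rotated gradient\<close>

lemma integrable_gaussian_pair:
  assumes "s > 0"
  shows "integrable (gaussian m s \<Otimes>\<^sub>M gaussian m' s) fst"
    and "integrable (gaussian m s \<Otimes>\<^sub>M gaussian m' s) snd"
proof -
  interpret N: real_distribution std_normal_distribution by (rule real_dist_normal_dist)
  interpret P: pair_prob_space std_normal_distribution std_normal_distribution ..
  show "integrable (gaussian m s \<Otimes>\<^sub>M gaussian m' s) fst"
    and "integrable (gaussian m s \<Otimes>\<^sub>M gaussian m' s) snd"
    unfolding gaussian_pair_affine[OF assms]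
    by (subst integrable_distr_eq; simp add: case_prod_beta' integrable_std_normal_pair)+
qed

text \<open>The library fact integral_bind only covers bounded integrands.\<close>

lemma integral_bind_finite_pmf:
  fixes f :: "'b \<Rightarrow> real"
  assumes fin: "finite (set_pmf p)"
    and N: "N \<in> measurable (measure_pmf p) (subprob_algebra B)"
    and f[measurable]: "f \<in> borel_measurable B"
    and int: "\<And>x. x \<in> set_pmf p \<Longrightarrow> integrable (N x) f"
  shows "(\<integral>z. f z \<partial>(measure_pmf p \<bind> N)) = (\<Sum>x\<in>set_pmf p. pmf p x * (\<integral>z. f z \<partial>N x))"
proof -
  have sets: "sets (measure_pmf p \<bind> N) = sets B"
    by (rule sets_bind_measurable[OF N]) simp
  \<comment> \<open>For nonnegative integrands the claim follows from the bind rule for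
    \<open>nn_integral\<close>; the general case subtracts the negative part from the positive
    part.\<close>
  have nonneg: "has_bochner_integral (measure_pmf p \<bind> N) g (\<Sum>x\<in>set_pmf p. pmf p x * (\<integral>z. g z \<partial>N x))"
    if g[measurable]: "g \<in> borel_measurable B" and g0: "\<And>z. 0 \<le> g z"
      and gint: "\<And>x. x \<in> set_pmf p \<Longrightarrow> integrable (N x) g" for g :: "'b \<Rightarrow> real"
  proof (rule has_bochner_integral_nn_integral)
    show "g \<in> borel_measurable (measure_pmf p \<bind> N)"
      by (simp add: measurable_cong_sets[OF sets refl])
    show "0 \<le> (\<Sum>x\<in>set_pmf p. pmf p x * (\<integral>z. g z \<partial>N x))"
      by (intro sum_nonneg mult_nonneg_nonneg integral_nonneg) (auto simp: g0)
    have "(\<integral>\<^sup>+z. ennreal (g z) \<partial>(measure_pmf p \<bind> N)) = (\<integral>\<^sup>+x. \<integral>\<^sup>+z. ennreal (g z) \<partial>N x \<partial>measure_pmf p)"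
      by (rule nn_integral_bind[OF _ N]) simp
    also have "\<dots> = (\<Sum>x\<in>set_pmf p. (\<integral>\<^sup>+z. ennreal (g z) \<partial>N x) * ennreal (pmf p x))"
      by (rule nn_integral_measure_pmf_finite[OF fin]) simp
    also have "\<dots> = (\<Sum>x\<in>set_pmf p. ennreal (pmf p x * (\<integral>z. g z \<partial>N x)))"
    proof (intro sum.cong refl)
      fix x assume x: "x \<in> set_pmf p"
      have "(\<integral>\<^sup>+z. ennreal (g z) \<partial>N x) = ennreal (\<integral>z. g z \<partial>N x)"
        by (intro nn_integral_eq_integral gint x) (simp add: g0)
      then show "(\<integral>\<^sup>+z. ennreal (g z) \<partial>N x) * ennreal (pmf p x) = ennreal (pmf p x * (\<integral>z. g z \<partial>N x))"
        by (simp add: ennreal_mult' mult.commute)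
    qed
    also have "\<dots> = ennreal (\<Sum>x\<in>set_pmf p. pmf p x * (\<integral>z. g z \<partial>N x))"
      by (subst sum_ennreal) (auto simp: g0)
    finally show "(\<integral>\<^sup>+z. ennreal (g z) \<partial>(measure_pmf p \<bind> N)) = ennreal (\<Sum>x\<in>set_pmf p. pmf p x * (\<integral>z. g z \<partial>N x))" .
  qed (simp add: g0)
  let ?g = "\<lambda>z. max 0 (f z)" and ?h = "\<lambda>z. max 0 (- f z)"
  have gint: "integrable (N x) ?g" and hint: "integrable (N x) ?h" if "x \<in> set_pmf p" for x
    using int[OF that] by auto
  have split: "f z = ?g z - ?h z" for z by simp
  have "has_bochner_integral (measure_pmf p \<bind> N) (\<lambda>z. ?g z - ?h z)
      ((\<Sum>x\<in>set_pmf p. pmf p x * (\<integral>z. ?g z \<partial>N x)) - (\<Sum>x\<in>set_pmf p. pmf p x * (\<integral>z. ?h z \<partial>N x)))"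
    by (intro has_bochner_integral_diff nonneg gint hint) auto
  then have "(\<integral>z. ?g z - ?h z \<partial>(measure_pmf p \<bind> N)) =
      (\<Sum>x\<in>set_pmf p. pmf p x * ((\<integral>z. ?g z \<partial>N x) - (\<integral>z. ?h z \<partial>N x)))"
    by (simp add: has_bochner_integral_integral_eq sum_subtractf right_diff_distrib)
  also have "\<dots> = (\<Sum>x\<in>set_pmf p. pmf p x * (\<integral>z. ?g z - ?h z \<partial>N x))"
    by (intro sum.cong refl) (simp add: Bochner_Integration.integral_diff gint hint)
  finally show ?thesis unfolding split[symmetric] .
qed

definition gaussian_moment :: "real \<Rightarrow> real ^ 2 \<Rightarrow> real ^ 2 \<Rightarrow> real \<Rightarrow> real \<Rightarrow> real" where
  "gaussian_moment s u v m1 m2 =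
    (\<integral>z. (u $ 1 * fst z + u $ 2 * snd z) * of_bool (0 \<le> v $ 1 * fst z + v $ 2 * snd z)
      \<partial>(gaussian m1 s \<Otimes>\<^sub>M gaussian m2 s))"

lemma borel_measurable_activation [measurable]:
  "(\<lambda>z :: (real ^ 2) \<times> real. (snd z * of_bool (v \<bullet> fst z \<ge> 0)) *\<^sub>R fst z) \<in> borel_measurable borel"
  by (subst borel_prod[symmetric]) measurable

lemma integrable_activation:
  assumes s: "s > 0"
  shows "integrable (mixture mu1 mu2 mu3 s) (\<lambda>z. (snd z * of_bool (v \<bullet> fst z \<ge> 0)) *\<^sub>R fst z)"
  by (rule Bochner_Integration.integrable_bound[OF integrable_mixture[OF s]])
    (auto simp: measurable_cong_sets[OF sets_mixture[OF s] refl])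

lemma cond_dist_activation:
  assumes s: "s > 0"
  shows "integrable (cond_dist mu1 mu2 mu3 s (y, e)) (\<lambda>z. u \<bullet> ((snd z * of_bool (v \<bullet> fst z \<ge> 0)) *\<^sub>R fst z))"
      (is "integrable _ ?f")
    and "(\<integral>z. u \<bullet> ((snd z * of_bool (v \<bullet> fst z \<ge> 0)) *\<^sub>R fst z) \<partial>cond_dist mu1 mu2 mu3 s (y, e)) =
      y * gaussian_moment s u v ((mu1 - mu3) / 2 + y * ((mu1 + mu3) / 2)) (mu2 * e * ((y + 1) / 2))"
proof -
  let ?P = "gaussian ((mu1 - mu3) / 2 + y * ((mu1 + mu3) / 2)) s \<Otimes>\<^sub>M gaussian (mu2 * e * ((y + 1) / 2)) s"
  let ?g = "\<lambda>z. y * ((u $ 1 * fst z + u $ 2 * snd z) * of_bool (0 \<le> v $ 1 * fst z + v $ 2 * snd z))"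
  have m: "?f \<in> borel_measurable borel" by measurable
  have eq: "u \<bullet> ((y * of_bool (v \<bullet> vector [fst z, snd z] \<ge> 0)) *\<^sub>R vector [fst z, snd z]) = ?g z" for z
    by (simp add: inner_vec_def sum_2 algebra_simps)
  have "integrable ?P ?g"
    by (intro integrable_mult_right integrable_mult_of_bool Bochner_Integration.integrable_add
        integrable_gaussian_pair[OF s]) measurable
  then show "integrable (cond_dist mu1 mu2 mu3 s (y, e)) ?f"
    unfolding cond_dist_def case_prod_conv
    by (subst integrable_distr_eq[OF measurable_vector2_pair m]) (simp only: case_prod_beta' fst_conv snd_conv eq)
  have "(\<integral>z. ?f z \<partial>cond_dist mu1 mu2 mu3 s (y, e)) = (\<integral>z. ?g z \<partial>?P)"
    unfolding cond_dist_def case_prod_conv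
    by (subst integral_distr[OF measurable_vector2_pair m]) (simp only: case_prod_beta' fst_conv snd_conv eq)
  then show "(\<integral>z. ?f z \<partial>cond_dist mu1 mu2 mu3 s (y, e)) =
      y * gaussian_moment s u v ((mu1 - mu3) / 2 + y * ((mu1 + mu3) / 2)) (mu2 * e * ((y + 1) / 2))"
    by (simp add: gaussian_moment_def)
qed

text \<open>The four sign pairs have weight 1/4 each. Label 1 yields the two clusters at
  \<open>(mu1, mu2)\<close> and \<open>(mu1, - mu2)\<close>; label -1 yields the cluster at
  \<open>(- mu3, 0)\<close> for both values of \<open>e\<close>, hence the factor 2 and the minus
  sign.\<close>

lemma mixture_activation:
  assumes s: "s > 0"
  shows "u \<bullet> (\<integral>z. (snd z * of_bool (v \<bullet> fst z \<ge> 0)) *\<^sub>R fst z \<partial>mixture mu1 mu2 mu3 s) =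
    (gaussian_moment s u v mu1 mu2 + gaussian_moment s u v mu1 (- mu2) - 2 * gaussian_moment s u v (- mu3) 0) / 4"
proof -
  let ?S = "pair_pmf (pmf_of_set {-1, 1 :: real}) (pmf_of_set {-1, 1 :: real})"
  let ?f = "\<lambda>z. u \<bullet> ((snd z * of_bool (v \<bullet> fst z \<ge> 0)) *\<^sub>R fst z)"
  have mean: "(mu1 - mu3) / 2 + (mu1 + mu3) / 2 = mu1" "(mu1 - mu3) / 2 + (- mu1 - mu3) / 2 = - mu3"
    by (simp_all add: field_simps)
  have set: "set_pmf ?S = {-1, 1} \<times> {-1, 1}" by (simp add: set_pair_pmf)
  have "u \<bullet> (\<integral>z. (snd z * of_bool (v \<bullet> fst z \<ge> 0)) *\<^sub>R fst z \<partial>mixture mu1 mu2 mu3 s) = (\<integral>z. ?f z \<partial>mixture mu1 mu2 mu3 s)"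
    by (rule integral_inner_right[symmetric]) (rule integrable_activation[OF s])
  also have "\<dots> = (\<Sum>x\<in>set_pmf ?S. pmf ?S x * (\<integral>z. ?f z \<partial>cond_dist mu1 mu2 mu3 s x))"
    unfolding mixture_def
    by (rule integral_bind_finite_pmf[OF finite_signs cond_dist_kernel[OF s]])
      (use cond_dist_activation(1)[OF s] in \<open>auto simp del: inner_scaleR_right\<close>)
  also have "\<dots> = (\<Sum>y\<in>{-1, 1}. \<Sum>e\<in>{-1, 1}. 1 / 4 * (\<integral>z. ?f z \<partial>cond_dist mu1 mu2 mu3 s (y, e)))"
    unfolding set sum.cartesian_product
    by (intro sum.cong refl) (auto simp: pmf_pair)
  also have "\<dots> = (gaussian_moment s u v mu1 mu2 + gaussian_moment s u v mu1 (- mu2)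
      - 2 * gaussian_moment s u v (- mu3) 0) / 4"
    unfolding cond_dist_activation(2)[OF s] by (simp add: mean)
  finally show ?thesis .
qed

text \<open>The rotation passes through the indicator as its transpose acting on the weight, and
  leaves the integral by linearity. The sign of the gradient can thus be read off from the unrotated
  mixture.\<close>

lemma loss_grad_rotated_mixture:
  assumes s: "s > 0"
  shows "loss_grad (rotated g (mixture mu1 mu2 mu3 s)) a W $ k =
    - (a $ k *\<^sub>R (rot g *v (\<integral>z. (snd z * of_bool ((transpose (rot g) *v W $ k) \<bullet> fst z \<ge> 0)) *\<^sub>R fst z
      \<partial>mixture mu1 mu2 mu3 s)))"
proof -
  let ?M = "mixture mu1 mu2 mu3 s" and ?v = "transpose (rot g) *v W $ k"
  have mr: "(\<lambda>(x, y). (rot g *v x, y)) \<in> measurable ?M borel"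
    using measurable_rot by (simp add: measurable_cong_sets[OF sets_mixture[OF s] refl])
  have "(\<integral>(x, y). (y * of_bool (W $ k \<bullet> x \<ge> 0)) *\<^sub>R x \<partial>rotated g ?M) =
    (\<integral>z. rot g *v ((snd z * of_bool (?v \<bullet> fst z \<ge> 0)) *\<^sub>R fst z) \<partial>?M)"
    unfolding rotated_def case_prod_beta'
    by (subst integral_distr[OF mr[unfolded case_prod_beta'] borel_measurable_activation])
      (simp add: inner_rot matrix_vector_mult_scaleR)
  also have "\<dots> = rot g *v (\<integral>z. (snd z * of_bool (?v \<bullet> fst z \<ge> 0)) *\<^sub>R fst z \<partial>?M)"
    by (rule integral_bounded_linear[OF matrix_vector_mul_bounded_linear integrable_activation[OF s]])
  finally show ?thesis by (simp add: loss_grad_def)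
qed

section \<open>Closed forms of the moments and positivity of the drift\<close>

lemma integral_gaussian_pair:
  assumes s: "s > 0"
  shows "integral\<^sup>L (gaussian m s \<Otimes>\<^sub>M gaussian m' s) fst = m"
    and "integral\<^sup>L (gaussian m s \<Otimes>\<^sub>M gaussian m' s) snd = m'"
proof -
  have fst: "integral\<^sup>L (gaussian m s \<Otimes>\<^sub>M gaussian m' s) fst = m" for m m'
  proof -
    interpret N: prob_space "gaussian m' s" by (rule prob_space_normal_density[OF s])
    have "integral\<^sup>L (gaussian m s \<Otimes>\<^sub>M gaussian m' s) fst = integral\<^sup>L (gaussian m s) (\<lambda>x. x)"
      by (subst (3) N.distr_pair_fst[symmetric], subst integral_distr) auto
    also have "\<dots> = m"
      using normal_moment_nz_1[OF s, of m]
      by (subst integral_density) (auto simp: has_bochner_integral_iff)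
    finally show ?thesis .
  qed
  show "integral\<^sup>L (gaussian m s \<Otimes>\<^sub>M gaussian m' s) fst = m" by (rule fst)
  interpret N: prob_space "gaussian m s" by (rule prob_space_normal_density[OF s])
  interpret N': prob_space "gaussian m' s" by (rule prob_space_normal_density[OF s])
  interpret P: pair_prob_space "gaussian m s" "gaussian m' s" ..
  show "integral\<^sup>L (gaussian m s \<Otimes>\<^sub>M gaussian m' s) snd = m'"
    using P.integral_product_swap[of snd] fst[of m' m] by (simp add: case_prod_beta')
qed

text \<open>At a zero weight the convention \<open>ReLU'(0) = 1\<close> makes the indicator
  constantly 1, so the moment is that of the whole plane.\<close>

lemma gaussian_moment_zero:
  assumes s: "s > 0"
  shows "gaussian_moment s u 0 m1 m2 = u $ 1 * m1 + u $ 2 * m2"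
  using integrable_gaussian_pair[OF s, of m1 m2] integral_gaussian_pair[OF s, of m1 m2]
  by (simp add: gaussian_moment_def)

lemma sum_squares_sgn:
  fixes v :: "real ^ 2"
  assumes "v \<noteq> 0"
  shows "(sgn v $ 1)\<^sup>2 + (sgn v $ 2)\<^sup>2 = 1"
proof -
  have "(sgn v $ 1)\<^sup>2 + (sgn v $ 2)\<^sup>2 = sgn v \<bullet> sgn v"
    by (simp add: inner_vec_def sum_2 power2_eq_square)
  also have "\<dots> = 1" using assms by (simp add: dot_square_norm norm_sgn)
  finally show ?thesis .
qed

text \<open>The half-plane depends only on the direction of \<open>v\<close>, so \<open>v\<close>
  may be replaced by the unit vector \<open>sgn v\<close>.\<close>

lemma gaussian_moment_eq:
  assumes s: "s > 0" and v: "v \<noteq> 0"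
  shows "gaussian_moment s u v m1 m2 =
    (u $ 1 * m1 + u $ 2 * m2) * Phi ((sgn v $ 1 * m1 + sgn v $ 2 * m2) / s) +
    s * (u \<bullet> sgn v) * std_normal_density ((sgn v $ 1 * m1 + sgn v $ 2 * m2) / s)"
proof -
  note n = sum_squares_sgn[OF v]
  have "0 \<le> sgn v $ 1 * x + sgn v $ 2 * y \<longleftrightarrow> 0 \<le> v $ 1 * x + v $ 2 * y" for x y
  proof -
    have "sgn v $ 1 * x + sgn v $ 2 * y = (v $ 1 * x + v $ 2 * y) / norm v"
      by (simp add: sgn_div_norm add_divide_distrib divide_inverse mult_ac ring_distribs)
    then show ?thesis using v by (simp add: zero_le_divide_iff)
  qed
  then have "gaussian_moment s u v m1 m2 = gaussian_moment s u (sgn v) m1 m2"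
    by (simp add: gaussian_moment_def)
  also have "\<dots> = (u $ 1 * m1 + u $ 2 * m2) * Phi ((sgn v $ 1 * m1 + sgn v $ 2 * m2) / s) +
    s * (u $ 1 * sgn v $ 1 + u $ 2 * sgn v $ 2) * std_normal_density ((sgn v $ 1 * m1 + sgn v $ 2 * m2) / s)"
    unfolding gaussian_moment_def by (rule gaussian_pair_halfplane_moment[OF s n])
  finally show ?thesis by (simp add: inner_vec_def sum_2)
qed

text \<open>Explains the choice of \<open>c\<close>: whatever the unit normal
  \<open>(n1, n2)\<close>, the cluster masses captured by the half-plane, the last one counted
  twice, add up to at least \<open>c\<close>. If \<open>n1 \<le> 0\<close>, the last cluster centre
  lies in the half-plane and its doubled mass is at least 1. Otherwise one of the first two clusters
  suffices: the better placed one has its centre at offset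
  \<open>mu / s * (n1 * h + \<bar>n2\<bar>)\<close>.\<close>

lemma sum_Phi_ge:
  assumes n: "(n1 :: real)\<^sup>2 + n2\<^sup>2 = 1" and s: "0 < s" and mu: "0 < mu" and h: "0 \<le> h" and h': "0 \<le> h'"
  shows "Phi (mu / s * min 1 h) \<le>
    Phi ((n1 * (mu * h) + n2 * mu) / s) + Phi ((n1 * (mu * h) - n2 * mu) / s) + 2 * Phi (- (n1 * (mu * h') / s))"
proof -
  interpret N: real_distribution std_normal_distribution by (rule real_dist_normal_dist)
  note nn = N.cdf_nonneg
  show ?thesis
  proof (cases "n1 \<le> 0")
    case True
    then have "0 \<le> - (n1 * (mu * h') / s)"
      using s mu h' by (simp add: divide_nonpos_pos mult_nonpos_nonneg)
    then have "1 \<le> 2 * Phi (- (n1 * (mu * h') / s))"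
      using Phi_ge_half by fastforce
    moreover have "Phi (mu / s * min 1 h) \<le> 1" by (rule N.cdf_bounded_prob)
    ultimately show ?thesis
      using nn[of "(n1 * (mu * h) + n2 * mu) / s"] nn[of "(n1 * (mu * h) - n2 * mu) / s"] by linarith
  next
    case False
    \<comment> \<open>The cross term \<open>2 * n1 * \<bar>n2\<bar>\<close> is nonnegative, so the
      sum of absolute values of a unit vector is at least 1.\<close>
    have "1 \<le> (n1 + \<bar>n2\<bar>)\<^sup>2" using n False by (simp add: power2_sum)
    then have "1 \<le> n1 + \<bar>n2\<bar>"
      using False by (intro power2_le_imp_le[of 1]) auto
    then have "min 1 h * 1 \<le> min 1 h * (n1 + \<bar>n2\<bar>)" using h by (intro mult_left_mono) auto
    also have "\<dots> \<le> n1 * h + \<bar>n2\<bar>"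
    proof -
      have "min 1 h * n1 \<le> h * n1" "min 1 h * \<bar>n2\<bar> \<le> 1 * \<bar>n2\<bar>"
        using False by (intro mult_right_mono; simp)+
      then show ?thesis by (simp add: algebra_simps)
    qed
    finally have "mu / s * min 1 h \<le> mu / s * (n1 * h + \<bar>n2\<bar>)"
      using mu s by (intro mult_left_mono) auto
    then have "Phi (mu / s * min 1 h) \<le> Phi (mu / s * (n1 * h + \<bar>n2\<bar>))"
      by (rule N.cdf_nondecreasing)
    also have "\<dots> \<le> Phi ((n1 * (mu * h) + n2 * mu) / s) + Phi ((n1 * (mu * h) - n2 * mu) / s)"
    proof (cases "n2 \<ge> 0")
      case True
      then have "mu / s * (n1 * h + \<bar>n2\<bar>) = (n1 * (mu * h) + n2 * mu) / s" by (simp add: field_simps)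
      then show ?thesis using nn[of "(n1 * (mu * h) - n2 * mu) / s"] by (simp only:)
    next
      case False
      then have "mu / s * (n1 * h + \<bar>n2\<bar>) = (n1 * (mu * h) - n2 * mu) / s" by (simp add: field_simps)
      then show ?thesis using nn[of "(n1 * (mu * h) + n2 * mu) / s"] by (simp only:)
    qed
    finally show ?thesis using nn[of "- (n1 * (mu * h') / s)"] by linarith
  qed
qed

lemma std_normal_density_le: "std_normal_density x \<le> 1 / sqrt (2 * pi)"
  by (simp add: std_normal_density_def divide_right_mono)

text \<open>
  Here p, p', p3 and q, q', q3 stand for the values of Phi and of the standard normal density
  at the three cluster means, and k for u \<bullet> v. The density terms are only q + q' - 2 q3, with both
  signs, which gives the bound 2 / sqrt (2 pi) that the noise condition can afford.
\<close>

lemma halfplane_moments_pos: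
  fixes mu w s c u1 u2 k p p' p3 q q' q3 :: real
  assumes mu: "0 < mu" and s: "0 < s" and w: "0 < w" and u1: "0 < u1"
    and p: "p \<le> 1" "p' \<le> 1" "0 \<le> p" "0 \<le> p'" "0 \<le> p3" and c: "c \<le> p + p' + 2 * p3"
    and q: "0 < q" "0 < q'" "0 < q3" "q \<le> 1 / sqrt (2 * pi)" "q' \<le> 1 / sqrt (2 * pi)" "q3 \<le> 1 / sqrt (2 * pi)"
    and k: "\<bar>k\<bar> \<le> 1"
    and noise: "s / mu \<le> sqrt (pi / 2) * (1 / 2 * (c * w - 2 / w) * u1 - \<bar>u2\<bar>)"
  shows "0 < ((u1 * (mu * ((w - 1 / w) / 2)) + u2 * mu) * p + s * k * q)
    + ((u1 * (mu * ((w - 1 / w) / 2)) - u2 * mu) * p' + s * k * q')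
    - 2 * (- (u1 * (mu * ((w + 1 / w) / 2))) * p3 + s * k * q3)"
proof -
  define r where "r = 1 / sqrt (2 * pi)"
  have r: "0 < r" by (simp add: r_def)
  \<comment> \<open>The factor \<open>sqrt (pi / 2)\<close> of the noise condition is the reciprocal
    of \<open>2 * r\<close>, twice the maximum of the standard normal density.\<close>
  have "2 * r * sqrt (pi / 2) = 1"
    by (simp add: r_def real_sqrt_mult real_sqrt_divide)
  then have "2 * r * (s / mu) \<le> 1 / 2 * (c * w - 2 / w) * u1 - \<bar>u2\<bar>"
    using mult_left_mono[OF noise, of "2 * r"] r by (simp add: mult.assoc[symmetric])
  from mult_left_mono[OF this, of mu] mu
  have noise': "2 * r * s \<le> mu * (1 / 2 * (c * w - 2 / w) * u1) - mu * \<bar>u2\<bar>"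
    by (simp add: right_diff_distrib)
  define Q where "Q = q + q' - 2 * q3"
  \<comment> \<open>Strict because all densities are positive; this is what makes the final
    inequality strict although the noise condition is not.\<close>
  have Q: "\<bar>Q\<bar> < 2 * r" using q unfolding Q_def r_def[symmetric] by linarith
  have "\<bar>k * Q\<bar> \<le> 1 * \<bar>Q\<bar>" unfolding abs_mult using k by (intro mult_right_mono) auto
  then have "- (2 * r) < k * Q" using Q by linarith
  then have noise_term: "- (2 * r * s) < s * (k * Q)"
    using mult_strict_left_mono[OF _ s, of "- (2 * r)" "k * Q"] by (simp add: mult_ac)
  have "\<bar>u2 * (p - p')\<bar> \<le> \<bar>u2\<bar> * 1" unfolding abs_mult using p by (intro mult_left_mono) auto
  then have "- \<bar>u2\<bar> \<le> u2 * (p - p')" by linarith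
  from mult_left_mono[OF this, of mu] mu
  have orth_term: "- (mu * \<bar>u2\<bar>) \<le> mu * (u2 * (p - p'))" by simp
  \<comment> \<open>The coefficients of \<open>w\<close> and \<open>1 / w\<close> are collected
    separately: the former is at least \<open>c\<close> by assumption, the latter at least -2
    because \<open>p\<close> and \<open>p'\<close> are at most 1.\<close>
  have "c * w - 2 / w \<le> w * (p + p' + 2 * p3) + 1 / w * (2 * p3 - p - p')"
  proof -
    have "c * w \<le> w * (p + p' + 2 * p3)" using mult_right_mono[OF c, of w] w by (simp add: mult.commute)
    moreover have "1 / w * (-2) \<le> 1 / w * (2 * p3 - p - p')" using p w by (intro mult_left_mono) auto
    ultimately show ?thesis by simp
  qed
  then have "mu * (1 / 2 * (c * w - 2 / w) * u1) \<le>
      mu * (1 / 2 * (w * (p + p' + 2 * p3) + 1 / w * (2 * p3 - p - p')) * u1)"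
    using mu u1 by (intro mult_left_mono mult_right_mono) auto
  then have "0 < mu * (1 / 2 * (w * (p + p' + 2 * p3) + 1 / w * (2 * p3 - p - p')) * u1)
      + mu * (u2 * (p - p')) + s * (k * Q)"
    using noise' noise_term orth_term by linarith
  also have "\<dots> = ((u1 * (mu * ((w - 1 / w) / 2)) + u2 * mu) * p + s * k * q)
    + ((u1 * (mu * ((w - 1 / w) / 2)) - u2 * mu) * p' + s * k * q')
    - 2 * (- (u1 * (mu * ((w + 1 / w) / 2))) * p3 + s * k * q3)"
    using w by (simp add: Q_def divide_simps) (simp add: algebra_simps)
  finally show ?thesis .
qed

text \<open>For nonzero \<open>v\<close> the closed form of the moments feeds
  \<open>halfplane_moments_pos\<close>, with \<open>sum_Phi_ge\<close> supplying the bound by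
  \<open>c\<close>. Zero is treated apart, as \<open>sgn v\<close> is then no unit vector: the
  contributions of the two opposite clusters along \<open>u $ 2\<close> cancel and
  \<open>u $ 1 * (mu * w) / 2\<close> remains.\<close>

lemma mixture_drift_pos:
  assumes s: "0 < s" and mu: "0 < mu" and w: "1 < w" and u: "norm u = 1" "0 < u $ 1"
    and c: "c = Phi (mu / s * min 1 ((w - 1 / w) / 2))"
    and noise: "s / mu \<le> sqrt (pi / 2) * (1 / 2 * (c * w - 2 / w) * u $ 1 - \<bar>u $ 2\<bar>)"
  shows "0 < u \<bullet> (\<integral>z. (snd z * of_bool (v \<bullet> fst z \<ge> 0)) *\<^sub>R fst z
    \<partial>mixture (mu * ((w - 1 / w) / 2)) mu (mu * ((w + 1 / w) / 2)) s)"
proof (cases "v = 0")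
  case True
  have eq: "(u $ 1 * m + u $ 2 * mu + (u $ 1 * m + u $ 2 * - mu) - 2 * (u $ 1 * - m' + u $ 2 * 0)) / 4 =
      u $ 1 * ((m + m') / 2)" for m m'
    by (simp add: field_simps)
  have "mu * ((w - 1 / w) / 2) + mu * ((w + 1 / w) / 2) = mu * w"
    by (simp add: field_simps)
  moreover have "0 < u $ 1 * ((mu * w) / 2)" using mu w u by simp
  ultimately show ?thesis
    unfolding mixture_activation[OF s] True gaussian_moment_zero[OF s] eq by (simp only:)
next
  case False
  interpret N: real_distribution std_normal_distribution by (rule real_dist_normal_dist)
  let ?n = "sgn v" and ?m1 = "mu * ((w - 1 / w) / 2)" and ?m3 = "mu * ((w + 1 / w) / 2)"
  have "1 / w \<le> 1" using w by simp
  then have h: "0 \<le> (w - 1 / w) / 2" "0 \<le> (w + 1 / w) / 2" 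
    using w by (auto intro: order.trans[OF _ less_imp_le[OF w]])
  note n = sum_squares_sgn[OF False]
  have k: "\<bar>u \<bullet> ?n\<bar> \<le> 1"
    using Cauchy_Schwarz_ineq2[of u ?n] u False by (simp add: norm_sgn)
  have "0 < ((u $ 1 * ?m1 + u $ 2 * mu) * Phi ((?n $ 1 * ?m1 + ?n $ 2 * mu) / s)
        + s * (u \<bullet> ?n) * std_normal_density ((?n $ 1 * ?m1 + ?n $ 2 * mu) / s))
      + ((u $ 1 * ?m1 - u $ 2 * mu) * Phi ((?n $ 1 * ?m1 - ?n $ 2 * mu) / s)
        + s * (u \<bullet> ?n) * std_normal_density ((?n $ 1 * ?m1 - ?n $ 2 * mu) / s))
      - 2 * (- (u $ 1 * ?m3) * Phi (- (?n $ 1 * ?m3 / s))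
        + s * (u \<bullet> ?n) * std_normal_density (- (?n $ 1 * ?m3 / s)))"
    using w sum_Phi_ge[OF n s mu h] unfolding c[symmetric]
    by (intro halfplane_moments_pos[OF mu s _ u(2) _ _ _ _ _ _ _ _ _ _ _ _ k noise])
      (simp_all add: N.cdf_nonneg N.cdf_bounded_prob normal_density_pos std_normal_density_le)
  then show ?thesis
    unfolding mixture_activation[OF s] gaussian_moment_eq[OF s False] by simp
qed

section \<open>Decision boundaries and the long-run behaviour of linearly growing weights\<close>

lemma decision_boundary_antidiagonal:
  fixes h :: "real ^ 2 \<Rightarrow> real"
  assumes pos: "\<And>x. 0 < x $ 1 + x $ 2 \<Longrightarrow> h x = p" and neg: "\<And>x. x $ 1 + x $ 2 < 0 \<Longrightarrow> h x = q"
    and "p \<noteq> q"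
  shows "decision_boundary h = {x. x $ 1 = - x $ 2}"
proof -
  have "(\<forall>\<^sub>F z in nhds x. h z = h x) \<longleftrightarrow> x $ 1 \<noteq> - x $ 2" for x :: "real ^ 2"
  proof (cases "x $ 1 + x $ 2" "0 :: real" rule: linorder_cases)
    case less
    have "open {z :: real ^ 2. z $ 1 + z $ 2 < 0}"
      by (intro open_Collect_less continuous_intros)
    then have "\<forall>\<^sub>F z in nhds x. z \<in> {z. z $ 1 + z $ 2 < 0}"
      using less by (intro eventually_nhds_in_open) auto
    then have "\<forall>\<^sub>F z in nhds x. h z = h x"
      by eventually_elim (use less neg in simp)
    then show ?thesis using less by simp
  next
    case greater
    have "open {z :: real ^ 2. 0 < z $ 1 + z $ 2}"
      by (intro open_Collect_less continuous_intros)
    then have "\<forall>\<^sub>F z in nhds x. z \<in> {z. 0 < z $ 1 + z $ 2}"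
      using greater by (intro eventually_nhds_in_open) auto
    then have "\<forall>\<^sub>F z in nhds x. h z = h x"
      by eventually_elim (use greater pos in simp)
    then show ?thesis using greater by simp
  next
    \<comment> \<open>The value of \<open>h\<close> on the line is unconstrained. Moving off
      \<open>x\<close> along \<open>(1, 1)\<close> and \<open>(- 1, - 1)\<close> meets both
      \<open>p\<close> and \<open>q\<close> arbitrarily near, so \<open>h\<close> cannot be constant
      around \<open>x\<close>.\<close>
    case equal
    have False if ev: "\<forall>\<^sub>F z in nhds x. h z = h x"
    proof -
      let ?z = "\<lambda>b n. x + (b * inverse (real (Suc n))) *\<^sub>R (vector [1, 1] :: real ^ 2)"
      have "?z b \<longlonglongrightarrow> x + (b * 0) *\<^sub>R vector [1, 1]" for b
        by (intro tendsto_intros LIMSEQ_inverse_real_of_nat)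
      then have "\<forall>\<^sub>F n in sequentially. h (?z b n) = h x" for b
        using eventually_compose_filterlim[OF ev, of "?z b" sequentially] by simp
      from eventually_conj[OF this[of 1] this[of "- 1"]]
      obtain n where n: "h (?z 1 n) = h x" "h (?z (- 1) n) = h x"
        using eventually_happens'[OF sequentially_bot] by blast
      have "h (?z 1 n) = p" "h (?z (- 1) n) = q"
        using equal by (auto intro!: pos neg simp: add_eq_0_iff)
      with n show False using assms(3) by simp
    qed
    then show ?thesis using equal by auto
  qed
  then show ?thesis unfolding decision_boundary_def by auto
qed

text \<open>Dividing by the step count does not change \<open>sgn\<close> and leaves
  \<open>e\<close> plus a vanishing term; \<open>sgn\<close> is continuous at
  \<open>e \<noteq> 0\<close>. The count \<open>Suc t\<close> avoids division by zero.\<close>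

lemma sgn_linear_growth_tendsto:
  fixes x e :: "'a::real_normed_vector"
  assumes "e \<noteq> 0"
  shows "(\<lambda>t. sgn (x + real t *\<^sub>R e)) \<longlonglongrightarrow> sgn e"
proof -
  have "(\<lambda>t. sgn (inverse (real (Suc t)) *\<^sub>R x + e)) \<longlonglongrightarrow> sgn (0 *\<^sub>R x + e)"
    using assms by (intro tendsto_sgn tendsto_intros LIMSEQ_inverse_real_of_nat) simp
  moreover have "sgn (inverse (real (Suc t)) *\<^sub>R x + e) = sgn (x + real (Suc t) *\<^sub>R e)" for t
  proof -
    have "x + real (Suc t) *\<^sub>R e = real (Suc t) *\<^sub>R (inverse (real (Suc t)) *\<^sub>R x + e)"
      by (simp add: scaleR_add_right del: of_nat_Suc)
    then show ?thesis by (simp only: sgn_scaleR) simp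
  qed
  ultimately have "(\<lambda>t. sgn (x + real (Suc t) *\<^sub>R e)) \<longlonglongrightarrow> sgn e" by simp
  then show ?thesis by (rule LIMSEQ_imp_Suc)
qed

lemma network_eq_sum: "network a W x = (\<Sum>k\<in>UNIV. a $ k * max 0 (W $ k \<bullet> x))"
  by (simp add: network_def inner_vec_def ReLU_def matrix_vector_mult_def)

text \<open>Eventually row \<open>k\<close> is active at \<open>x\<close> exactly when
  \<open>a $ k\<close> equals the sign of \<open>x $ 1 + x $ 2\<close>; all other rows output
  exactly 0. So the network has the expected sign if some outer weight carries it, and is exactly 0
  otherwise.\<close>

lemma sgn_network_eventually:
  fixes a :: "real ^ 'm::finite" and W :: "nat \<Rightarrow> real ^ 2 ^ 'm"
  assumes a: "\<And>k. a $ k \<in> {-1, 1}" and eta: "0 < \<eta>"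
    and W: "\<And>t k. W t $ k = W 0 $ k + real t *\<^sub>R ((\<eta> * a $ k) *\<^sub>R vector [1, 1])"
    and x: "x $ 1 + x $ 2 \<noteq> 0"
  shows "\<forall>\<^sub>F t in sequentially. sgn (network a (W t) x) =
    (if \<exists>k. a $ k = sgn (x $ 1 + x $ 2) then sgn (x $ 1 + x $ 2) else 0)"
proof -
  define b where "b = sgn (x $ 1 + x $ 2)"
  have b: "b = 1 \<or> b = - 1" using x by (auto simp: b_def sgn_if)
  have "\<forall>\<^sub>F t in sequentially. 0 < a $ k * b * (W t $ k \<bullet> x)" for k
  proof -
    \<comment> \<open>Since \<open>(a $ k)^2 = 1\<close>, the signed preactivation is its initial
      value plus a positive multiple of \<open>t\<close>.\<close>
    have eq: "a $ k * b * (W t $ k \<bullet> x) = a $ k * b * (W 0 $ k \<bullet> x) + real t * (\<eta> * \<bar>x $ 1 + x $ 2\<bar>)" for t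
    proof -
      have "a $ k * a $ k = 1" using a[of k] by auto
      moreover have "W t $ k \<bullet> x = W 0 $ k \<bullet> x + real t * \<eta> * a $ k * (x $ 1 + x $ 2)"
        by (subst W) (simp add: inner_add_left inner_vec_def[of "vector _"] sum_2)
      moreover have "a $ k * b * (W 0 $ k \<bullet> x + real t * \<eta> * a $ k * (x $ 1 + x $ 2)) =
          a $ k * b * (W 0 $ k \<bullet> x) + real t * (\<eta> * ((a $ k * a $ k) * ((x $ 1 + x $ 2) * b)))"
        by (simp add: algebra_simps)
      ultimately show ?thesis
        unfolding abs_sgn b_def[symmetric] by simp
    qed
    have lim: "filterlim (\<lambda>t. real t * (\<eta> * \<bar>x $ 1 + x $ 2\<bar>)) at_top sequentially"
      by (rule filterlim_at_top_mult_tendsto_pos[OF tendsto_const _ filterlim_real_sequentially]) (use eta x in simp)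
    have "filterlim (\<lambda>t. a $ k * b * (W t $ k \<bullet> x)) at_top sequentially"
      by (rule filterlim_tendsto_add_at_top[OF tendsto_const lim, of "a $ k * b * (W 0 $ k \<bullet> x)", folded eq])
    then show ?thesis by (simp add: filterlim_at_top_dense)
  qed
  then have "\<forall>\<^sub>F t in sequentially. \<forall>k. 0 < a $ k * b * (W t $ k \<bullet> x)"
    by (rule eventually_all_finite)
  then show ?thesis
  proof eventually_elim
    case (elim t)
    \<comment> \<open>Where \<open>a $ k = - b\<close> the preactivation is negative and the ReLU
      removes it; the surviving terms share the factor \<open>b\<close>.\<close>
    have "network a (W t) x = (\<Sum>k\<in>UNIV. b * (if a $ k = b then W t $ k \<bullet> x else 0))"
      unfolding network_eq_sum
    proof (intro sum.cong refl)
      fix k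
      show "a $ k * max 0 (W t $ k \<bullet> x) = b * (if a $ k = b then W t $ k \<bullet> x else 0)"
        using a[of k] b elim[rule_format, of k] by auto
    qed
    then have eq: "network a (W t) x = b * (\<Sum>k\<in>UNIV. if a $ k = b then W t $ k \<bullet> x else 0)"
      by (simp add: sum_distrib_left)
    have pos: "0 < W t $ k \<bullet> x" if "a $ k = b" for k
      using elim[rule_format, of k] that b by auto
    show ?case
    proof (cases "\<exists>k. a $ k = b")
      case True
      then obtain k where k: "a $ k = b" ..
      have "0 < (\<Sum>k\<in>UNIV. if a $ k = b then W t $ k \<bullet> x else 0)"
        by (rule sum_pos2[of UNIV k]) (use k pos in \<open>auto intro: less_imp_le\<close>)
      then show ?thesis using True b unfolding eq b_def[symmetric] by (simp add: sgn_mult) auto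
    next
      case False
      then show ?thesis unfolding eq b_def[symmetric] by simp
    qed
  qed
qed

section \<open>Sign gradient descent: trajectory, limiting direction and limiting classifier\<close>

theorem theorem3:
  fixes \<gamma> \<mu>1 \<mu>2 \<mu>3 \<sigma> \<mu> \<omega> S c \<eta> :: real
    and a :: "real ^ 'm::finite"
    and D :: "((real ^ 2) \<times> real) measure"
    and W :: "nat \<Rightarrow> real ^ 2 ^ 'm"
  assumes gamma: "0 < \<gamma>" "\<gamma> \<le> pi / 4"
    and a: "\<And>k. a $ k \<in> {-1, 1}"
    and sigma: "\<sigma> > 0"
    and mu: "\<mu> = \<mu>2"
    and omega: "\<omega> = (\<mu>1 + \<mu>3) / \<mu>2"
    and S: "S = \<mu> / \<sigma>" "S > 0"
    and mu1: "\<mu>1 = \<mu> / 2 * (\<omega> - 1 / \<omega>)"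
    and mu3: "\<mu>3 = \<mu> / 2 * (\<omega> + 1 / \<omega>)"
    and c: "c = Phi (S * min 1 ((\<omega> - 1 / \<omega>) / 2))" "c \<in> {1/2..1}"
    and omega_gt: "\<omega> > sqrt (2 / c)"
    and noise: "1 / S \<le> sqrt (pi / 2) * (1 / 2 * (c * \<omega> - 2 / \<omega>) * sin \<gamma> - cos \<gamma>)"
    and D: "D = rotated \<gamma> (mixture \<mu>1 \<mu>2 \<mu>3 \<sigma>)"
    and eta: "\<eta> > 0"
    and sign_gd: "\<And>t. W (Suc t) = W t - \<eta> *\<^sub>R sign_mat (loss_grad D a (W t))"
  shows "(\<forall>k. (\<lambda>t. W t $ k /\<^sub>R norm (W t $ k)) \<longlonglongrightarrow> (a $ k / sqrt 2) *\<^sub>R vector [1, 1])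
    \<and> (\<forall>x. convergent (\<lambda>t. sgn (network a (W t) x)))
    \<and> (\<forall>x. x $ 1 + x $ 2 \<noteq> 0 \<longrightarrow> (\<exists>k. a $ k = sgn (x $ 1 + x $ 2)) \<longrightarrow>
          (\<lambda>t. sgn (network a (W t) x)) \<longlonglongrightarrow> sgn (x $ 1 + x $ 2))
    \<and> decision_boundary (\<lambda>x. lim (\<lambda>t. sgn (network a (W t) x))) = {x. x $ 1 = - x $ 2}
    \<and> decision_boundary (\<lambda>x :: real ^ 2. sgn (x $ 1 + x $ 2)) = {x. x $ 1 = - x $ 2}
    \<and> subspace {x :: real ^ 2. x $ 1 = - x $ 2}"
proof -
  have a0: "a $ k \<noteq> 0" for k using a[of k] by auto
  have mu_pos: "0 < \<mu>" using S sigma by (simp add: zero_less_divide_iff)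
  have "1 \<le> sqrt (2 / c)" using c(2) by simp
  then have omega1: "1 < \<omega>" using omega_gt by (rule le_less_trans)
  have sin: "0 < sin \<gamma>" using gamma pi_gt_zero by (intro sin_gt_zero) linarith+
  have "cos (pi / 2 - \<gamma>) \<le> cos \<gamma>" using gamma pi_gt_zero by (intro cos_monotone_0_pi_le) linarith+
  \<comment> \<open>This is where \<open>\<gamma> \<le> pi / 4\<close> enters: it puts the row
    \<open>(cos \<gamma>, - sin \<gamma>)\<close> of the rotation within the range covered by
    \<open>noise'\<close>.\<close>
  then have sin_cos: "sin \<gamma> \<le> cos \<gamma>" by (simp add: cos_diff)
  have c': "c = Phi (\<mu> / \<sigma> * min 1 ((\<omega> - 1 / \<omega>) / 2))" using c(1) S(1) by simp
  have noise': "\<sigma> / \<mu> \<le> sqrt (pi / 2) * (1 / 2 * (c * \<omega> - 2 / \<omega>) * u1 - \<bar>u2\<bar>)"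
    if "sin \<gamma> \<le> u1" "\<bar>u2\<bar> \<le> cos \<gamma>" for u1 u2
  proof -
    \<comment> \<open>Positivity of \<open>1 / S\<close> forces the coefficient of
      \<open>sin \<gamma>\<close> to be positive, so the right-hand side of the noise condition can
      only grow when \<open>sin \<gamma>\<close> is raised to \<open>u1\<close> and
      \<open>cos \<gamma>\<close> lowered to \<open>\<bar>u2\<bar>\<close>.\<close>
    have "0 < 1 / S" using S(2) by simp
    also note noise
    finally have "cos \<gamma> < 1 / 2 * (c * \<omega> - 2 / \<omega>) * sin \<gamma>"
      by (simp add: zero_less_mult_iff)
    then have "0 < 1 / 2 * (c * \<omega> - 2 / \<omega>) * sin \<gamma>" using sin sin_cos by linarith
    then have "0 < 1 / 2 * (c * \<omega> - 2 / \<omega>)" using sin by (simp only: zero_less_mult_iff) linarith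
    then have "1 / 2 * (c * \<omega> - 2 / \<omega>) * sin \<gamma> \<le> 1 / 2 * (c * \<omega> - 2 / \<omega>) * u1"
      using that(1) by (rule mult_left_mono[OF _ less_imp_le, rotated])
    then have rhs: "sqrt (pi / 2) * (1 / 2 * (c * \<omega> - 2 / \<omega>) * sin \<gamma> - cos \<gamma>) \<le>
        sqrt (pi / 2) * (1 / 2 * (c * \<omega> - 2 / \<omega>) * u1 - \<bar>u2\<bar>)"
      using that(2) by (intro mult_left_mono[OF diff_mono]) simp_all
    have "\<sigma> / \<mu> = 1 / S" by (simp add: S(1))
    also note noise
    also note rhs
    finally show ?thesis .
  qed
  have grad: "sgn (loss_grad D a V $ k $ j) = - a $ k" for V k j
  proof -
    define E where "E = (\<integral>z. (snd z * of_bool ((transpose (rot \<gamma>) *v V $ k) \<bullet> fst z \<ge> 0)) *\<^sub>R fst z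
      \<partial>mixture \<mu>1 \<mu>2 \<mu>3 \<sigma>)"
    \<comment> \<open>Applied below to the two rows of \<open>rot \<gamma>\<close>, whose inner
      products with \<open>E\<close> are the components of the rotated moment.\<close>
    have drift: "0 < u \<bullet> E" if "norm u = 1" "sin \<gamma> \<le> u $ 1" "\<bar>u $ 2\<bar> \<le> cos \<gamma>" for u
      using mixture_drift_pos[OF sigma mu_pos omega1 that(1) _ c' noise'[OF that(2,3)],
          of "transpose (rot \<gamma>) *v V $ k"] sin that
      by (simp add: E_def mu1 mu3 mu[symmetric])
    have norms: "norm (vector [cos \<gamma>, - sin \<gamma>] :: real ^ 2) = 1" "norm (vector [sin \<gamma>, cos \<gamma>] :: real ^ 2) = 1"
      by (simp_all add: norm_vec_def L2_set_def sum_2)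
    have "0 < (rot \<gamma> *v E) $ 1"
      using drift[of "vector [cos \<gamma>, - sin \<gamma>]"] norms sin sin_cos
      by (simp add: rot_def matrix_vector_mult_def inner_vec_def sum_2)
    moreover have "0 < (rot \<gamma> *v E) $ 2"
      using drift[of "vector [sin \<gamma>, cos \<gamma>]"] norms sin sin_cos
      by (simp add: rot_def matrix_vector_mult_def inner_vec_def sum_2)
    ultimately have "0 < (rot \<gamma> *v E) $ j" using exhaust_2[of j] by auto
    then have "sgn (- (a $ k * (rot \<gamma> *v E) $ j)) = - a $ k"
      using a[of k] by (auto simp: sgn_mult)
    then show ?thesis
      unfolding D loss_grad_rotated_mixture[OF sigma] E_def[symmetric] by simp
  qed
  have W: "W t $ k = W 0 $ k + real t *\<^sub>R ((\<eta> * a $ k) *\<^sub>R vector [1, 1])" for t k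
  proof (induction t)
    case (Suc t)
    have "sign_mat (loss_grad D a (W t)) $ k = - (a $ k *\<^sub>R vector [1, 1])"
      by (simp add: sign_mat_def vec_eq_iff forall_2 grad)
    then have "W (Suc t) $ k = W t $ k + (\<eta> * a $ k) *\<^sub>R vector [1, 1]"
      by (subst sign_gd) simp
    then show ?case by (simp add: Suc.IH algebra_simps)
  qed simp
  have norm1: "norm (vector [1, 1] :: real ^ 2) = sqrt 2"
    by (simp add: norm_vec_def L2_set_def sum_2)
  have direction: "(\<lambda>t. W t $ k /\<^sub>R norm (W t $ k)) \<longlonglongrightarrow> (a $ k / sqrt 2) *\<^sub>R vector [1, 1]" for k
  proof -
    have "sgn ((\<eta> * a $ k) *\<^sub>R (vector [1, 1] :: real ^ 2)) = (a $ k / sqrt 2) *\<^sub>R vector [1, 1]"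
      using a[of k] eta by (auto simp: sgn_scaleR sgn_mult) (auto simp: sgn_div_norm norm1 field_simps)
    moreover have "(\<eta> * a $ k) *\<^sub>R (vector [1, 1] :: real ^ 2) \<noteq> 0"
      using eta a0 by (simp add: vec_eq_iff forall_2)
    ultimately show ?thesis
      using sgn_linear_growth_tendsto[of "(\<eta> * a $ k) *\<^sub>R (vector [1, 1] :: real ^ 2)" "W 0 $ k"]
      unfolding sgn_div_norm[symmetric] by (subst W) simp
  qed
  \<comment> \<open>The limiting sign on each side of the line; it is 0 on a side whose sign no
    outer weight carries.\<close>
  define L where "L = (\<lambda>b. if \<exists>k. a $ k = b then b else 0)"
  have limit: "(\<lambda>t. sgn (network a (W t) x)) \<longlonglongrightarrow> L (sgn (x $ 1 + x $ 2))" if "x $ 1 + x $ 2 \<noteq> 0" for x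
    using sgn_network_eventually[OF a eta W that] unfolding L_def by (rule tendsto_eventually)
  have conv: "convergent (\<lambda>t. sgn (network a (W t) x))" for x
  proof (cases "x $ 1 + x $ 2 = 0")
    case True
    \<comment> \<open>Here \<open>x\<close> is orthogonal to the direction \<open>(1, 1)\<close> in
      which every row moves, so the output never changes.\<close>
    have inner: "W t $ k \<bullet> x = W 0 $ k \<bullet> x" for t k
      using True by (subst W) (simp add: inner_add_left inner_vec_def[of "vector _"] sum_2)
    have "network a (W t) x = network a (W 0) x" for t
      unfolding network_eq_sum by (intro sum.cong refl) (simp only: inner[of t])
    then have "(\<lambda>t. sgn (network a (W t) x)) = (\<lambda>_. sgn (network a (W 0) x))"
      by (intro ext arg_cong[of _ _ sgn])
    then show ?thesis by (simp only: convergent_const)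
  next
    case False
    then show ?thesis using limit by (auto simp: convergent_def)
  qed
  \<comment> \<open>There is at least one row, \<open>undefined\<close> being a witness, so
    \<open>L 1\<close> and \<open>L (- 1)\<close> are not both 0. The limiting rule thus changes
    across the line even if all outer weights agree.\<close>
  have "L 1 \<noteq> L (- 1)"
    using a[of undefined] by (auto simp: L_def)
  then have boundary: "decision_boundary (\<lambda>x. lim (\<lambda>t. sgn (network a (W t) x))) = {x. x $ 1 = - x $ 2}"
    by (intro decision_boundary_antidiagonal[where p = "L 1" and q = "L (- 1)"])
      (use limI[OF limit] in auto)
  have boundary': "decision_boundary (\<lambda>x :: real ^ 2. sgn (x $ 1 + x $ 2)) = {x. x $ 1 = - x $ 2}"
    by (intro decision_boundary_antidiagonal[where p = 1 and q = "- 1"]) auto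
  have "subspace {x :: real ^ 2. x $ 1 = - x $ 2}"
    by (auto simp: subspace_def algebra_simps)
  moreover have "(\<lambda>t. sgn (network a (W t) x)) \<longlonglongrightarrow> sgn (x $ 1 + x $ 2)"
    if "x $ 1 + x $ 2 \<noteq> 0" "\<exists>k. a $ k = sgn (x $ 1 + x $ 2)" for x
    using limit[OF that(1)] that(2) by (simp add: L_def)
  ultimately show ?thesis
    using direction conv boundary boundary' by blast
qed
end
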